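(* $\mathbf{PTW}\subseteq\mathbf{S_2^P}$.
   Context: Decision problems are identified with languages over $\Sigma=\{0,1\}$ under a standard encoding; $A\leq_P B$ means that $A$ is many-one reducible to $B$ in polynomial time. $\Vert$ denotes concatenation of bit strings. The problem Weak-Tournament-Source: the input is a Boolean circuit $C\colon\{0,1\}^{2n}\to\{0,1\}$; the question is whether there exists $x\in\{0,1\}^n$ such that for all $y\in\{0,1\}^n$ with $y\neq x$ we have $C(x\Vert y)=1$ and $C(y\Vert x)=0$. The class Polynomial Tournament Winner is $\mathbf{PTW}=\{L\subseteq\Sigma^*: L\leq_P \text{Weak-Tournament-Source}\}$. The class $\mathbf{S_2^P}$: a language $L\subseteq\Sigma^*$ is in $\mathbf{S_2^P}$ if there is a polynomial-time predicate $P(\cdot,\cdot,\cdot)$ such that for all $w\in\Sigma^*$: (i) $w\in L\implies \exists x\,\forall y\; P(w,x,y)=1$, and (ii) $w\notin L\implies\exists y\,\forall x\; P(w,x,y)=0$, where $|x|$ and $|y|$ are bounded by a polynomial function of $|w|$. *)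

theory Defs
  imports Main "HOL-Computational_Algebra.Polynomial"
begin

section \<open>Multi-tape Turing machines\<close>

datatype symbol = Blank | Bit bool | Aux nat

datatype move = MoveLeft | Stay | MoveRight

text \<open>A two-way infinite tape is described relative to its head: cell \<open>0\<close> is the scanned cell
  and cell \<open>i\<close> lies \<open>i\<close> positions to its right. Moving the head therefore shifts the tape.\<close>

type_synonym tape = "int \<Rightarrow> symbol"

fun move_head :: "move \<Rightarrow> tape \<Rightarrow> tape" where
  "move_head MoveLeft t = (\<lambda>i. t (i - 1))"
| "move_head Stay t = t"
| "move_head MoveRight t = (\<lambda>i. t (i + 1))"

definition act :: "symbol \<times> move \<Rightarrow> tape \<Rightarrow> tape" where
  "act a t = move_head (snd a) (t(0 := fst a))"

record tm =
  num_tapes :: nat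
  states :: "nat set"
  alphabet :: "symbol set"
  start_state :: nat
  halt_state :: nat
  trans :: "nat \<Rightarrow> symbol list \<Rightarrow> nat \<times> (symbol \<times> move) list"

text \<open>The transition function matters only on the finitely many combinations of a non-halting
  state with one scanned tape symbol per tape; its other values are irrelevant.\<close>

definition valid_tm :: "tm \<Rightarrow> bool" where
  "valid_tm M \<longleftrightarrow>
     num_tapes M > 0 \<and> finite (states M) \<and> finite (alphabet M) \<and>
     insert Blank (range Bit) \<subseteq> alphabet M \<and>
     start_state M \<in> states M \<and> halt_state M \<in> states M \<and>
     (\<forall>q \<in> states M - {halt_state M}. \<forall>ss. length ss = num_tapes M \<and> set ss \<subseteq> alphabet M \<longrightarrow>
        fst (trans M q ss) \<in> states M \<and>
        length (snd (trans M q ss)) = num_tapes M \<and>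
        fst ` set (snd (trans M q ss)) \<subseteq> alphabet M)"

type_synonym config = "nat \<times> tape list"

definition step :: "tm \<Rightarrow> config \<Rightarrow> config" where
  "step M = (\<lambda>(q, ts).
     if q = halt_state M then (q, ts)
     else let (q', as) = trans M q (map (\<lambda>t. t 0) ts) in (q', map2 act as ts))"

definition word_tape :: "bool list \<Rightarrow> tape" where
  "word_tape w = (\<lambda>i. if 0 \<le> i \<and> i < int (length w) then Bit (w ! nat i) else Blank)"

text \<open>The arguments of a function of several words are placed on the first tapes, one each;
  the remaining tapes are blank.\<close>

definition init_config :: "tm \<Rightarrow> bool list list \<Rightarrow> config" where
  "init_config M ws =
     (start_state M,
      map word_tape ws @ replicate (num_tapes M - length ws) (word_tape []))"

text \<open>The word read off a tape starts at the head and extends to the next blank.\<close>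

definition tape_reads :: "tape \<Rightarrow> bool list \<Rightarrow> bool" where
  "tape_reads t w \<longleftrightarrow> (\<forall>i < length w. t (int i) = Bit (w ! i)) \<and> t (int (length w)) = Blank"

text \<open>The output is found on the first tape. Since halting configurations are fixed points of
  \<^const>\<open>step\<close>, \<open>yields_within M ws T v\<close> says that \<open>M\<close> halts after at most \<open>T\<close> steps.\<close>

definition yields_within :: "tm \<Rightarrow> bool list list \<Rightarrow> nat \<Rightarrow> bool list \<Rightarrow> bool" where
  "yields_within M ws T v \<longleftrightarrow>
     (let (q, ts) = (step M ^^ T) (init_config M ws)
      in q = halt_state M \<and> tape_reads (hd ts) v)"

definition polytime :: "nat \<Rightarrow> (bool list list \<Rightarrow> bool list) \<Rightarrow> bool" where
  "polytime k f \<longleftrightarrow>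
     (\<exists>M (p :: nat poly). valid_tm M \<and> k \<le> num_tapes M \<and>
        (\<forall>ws. length ws = k \<longrightarrow>
           yields_within M ws (poly p (sum_list (map length ws))) (f ws)))"

definition polytime_fun :: "(bool list \<Rightarrow> bool list) \<Rightarrow> bool" where
  "polytime_fun f \<longleftrightarrow> polytime 1 (\<lambda>ws. f (ws ! 0))"

definition polytime_pred3 :: "(bool list \<Rightarrow> bool list \<Rightarrow> bool list \<Rightarrow> bool) \<Rightarrow> bool" where
  "polytime_pred3 P \<longleftrightarrow> polytime 3 (\<lambda>ws. [P (ws ! 0) (ws ! 1) (ws ! 2)])"

section \<open>Languages, reductions, and the class S2P\<close>

type_synonym lang = "bool list set"

definition poly_reducible :: "lang \<Rightarrow> lang \<Rightarrow> bool" (infix \<open>\<le>\<^sub>P\<close> 50) where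
  "A \<le>\<^sub>P B \<longleftrightarrow> (\<exists>f. polytime_fun f \<and> (\<forall>w. w \<in> A \<longleftrightarrow> f w \<in> B))"

definition S2P :: "lang set" where
  "S2P = {L. \<exists>P (p :: nat poly). polytime_pred3 P \<and>
     (\<forall>w. (w \<in> L \<longrightarrow>
             (\<exists>x. length x \<le> poly p (length w) \<and>
               (\<forall>y. length y \<le> poly p (length w) \<longrightarrow> P w x y))) \<and>
          (w \<notin> L \<longrightarrow>
             (\<exists>y. length y \<le> poly p (length w) \<and>
               (\<forall>x. length x \<le> poly p (length w) \<longrightarrow> \<not> P w x y))))}"

section \<open>Boolean circuits\<close>

text \<open>The wires of a circuit are numbered consecutively: first its inputs, then the outputs of its
  gates in the listed (topological) order. Gates and the circuit output refer to wires by number.\<close>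

datatype gate = ConstGate bool | NotGate nat | AndGate nat nat | OrGate nat nat

record circuit =
  num_inputs :: nat
  out_wire :: nat
  gates :: "gate list"

fun operands :: "gate \<Rightarrow> nat set" where
  "operands (ConstGate b) = {}"
| "operands (NotGate i) = {i}"
| "operands (AndGate i j) = {i, j}"
| "operands (OrGate i j) = {i, j}"

definition valid_circuit :: "circuit \<Rightarrow> bool" where
  "valid_circuit C \<longleftrightarrow>
     (\<forall>g < length (gates C). \<forall>i \<in> operands (gates C ! g). i < num_inputs C + g) \<and>
     out_wire C < num_inputs C + length (gates C)"

fun gate_value :: "bool list \<Rightarrow> gate \<Rightarrow> bool" where
  "gate_value vs (ConstGate b) = b"
| "gate_value vs (NotGate i) = (\<not> vs ! i)"
| "gate_value vs (AndGate i j) = (vs ! i \<and> vs ! j)"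
| "gate_value vs (OrGate i j) = (vs ! i \<or> vs ! j)"

definition wire_values :: "circuit \<Rightarrow> bool list \<Rightarrow> bool list" where
  "wire_values C z = foldl (\<lambda>vs g. vs @ [gate_value vs g]) z (gates C)"

definition eval_circuit :: "circuit \<Rightarrow> bool list \<Rightarrow> bool" where
  "eval_circuit C z = wire_values C z ! out_wire C"

text \<open>Numbers are written in unary. As wire numbers of a valid circuit are smaller than its number
  of wires, the length of this encoding is polynomially related to the size of the circuit.\<close>

definition enc_nat :: "nat \<Rightarrow> bool list" where
  "enc_nat k = replicate k True @ [False]"

fun enc_gate :: "gate \<Rightarrow> bool list" where
  "enc_gate (ConstGate b) = [False, False, b]"
| "enc_gate (NotGate i) = [False, True] @ enc_nat i"
| "enc_gate (AndGate i j) = [True, False] @ enc_nat i @ enc_nat j"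
| "enc_gate (OrGate i j) = [True, True] @ enc_nat i @ enc_nat j"

definition enc_circuit :: "circuit \<Rightarrow> bool list" where
  "enc_circuit C =
     enc_nat (num_inputs C) @ enc_nat (out_wire C) @ concat (map enc_gate (gates C))"

lemma enc_nat_append_eq_iff: "enc_nat k @ u = enc_nat l @ v \<longleftrightarrow> k = l \<and> u = v"
proof (induction k arbitrary: l)
  case 0
  then show ?case by (cases l) (auto simp: enc_nat_def)
next
  case (Suc k)
  then show ?case by (cases l) (auto simp: enc_nat_def)
qed

lemma enc_gate_append_eq_iff: "enc_gate g @ u = enc_gate h @ v \<longleftrightarrow> g = h \<and> u = v"
  by (cases g; cases h) (auto simp: enc_nat_append_eq_iff)

lemma enc_gates_eq_iff: "concat (map enc_gate gs) = concat (map enc_gate hs) \<longleftrightarrow> gs = hs"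
proof (induction gs arbitrary: hs)
  case Nil
  have "enc_gate h \<noteq> []" for h by (cases h) auto
  then show ?case by (cases hs) auto
next
  case (Cons g gs)
  have "enc_gate g \<noteq> []" by (cases g) auto
  with Cons show ?case by (cases hs) (auto simp: enc_gate_append_eq_iff)
qed

lemma inj_enc_circuit: "inj enc_circuit"
  by (rule injI) (auto simp: enc_circuit_def enc_nat_append_eq_iff enc_gates_eq_iff)

section \<open>Weak-Tournament-Source and PTW\<close>

text \<open>Words that do not encode a valid circuit with an even number of inputs are no-instances.\<close>

definition weak_tournament_source :: lang where
  "weak_tournament_source = {enc_circuit C | C n.
     valid_circuit C \<and> num_inputs C = 2 * n \<and>
     (\<exists>x. length x = n \<and>
        (\<forall>y. length y = n \<and> y \<noteq> x \<longrightarrow>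
           eval_circuit C (x @ y) \<and> \<not> eval_circuit C (y @ x)))}"

definition PTW :: "lang set" where
  "PTW = {L. L \<le>\<^sub>P weak_tournament_source}"

end

theory Submission
  imports Defs "HOL-Library.Sublist"
begin

text \<open>Say that \<open>y\<close> refutes \<open>x\<close> if \<open>y \<noteq> x\<close> and \<open>C(xy) = 0\<close> or \<open>C(yx) = 1\<close>. Of two distinct strings at
  least one refutes the other, so as in a tournament there is a set of at most \<open>n + 1\<close> strings that
  refutes every string outside of it; if there is no source, adding one refuter for each member gives
  at most \<open>2(n + 1)\<close> strings that together refute every \<open>x\<close>. Hence the second prover can
  send such a list of strings, and the verifier accepts if \<open>x\<close> is refuted by none of them. A source
  survives every list.

  The verifier has to be a Turing machine. It is written in a structured language whose residual
  programs serve as the states of the machine; there are only finitely many of them.\<close>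

section \<open>Structured programs and their compilation\<close>

text \<open>Of two distinct strings, \<open>x\<close> refutes \<open>y\<close> if
  \<open>C(xy) = 1\<close>, and \<open>y\<close> refutes \<open>x\<close> otherwise. Refutation is a
  disjunction, while a block tests only one order of the two strings, so every refuter is sent
  twice; this accounts for the factor 4 in the bound on the length of \<open>y\<close>.

  Neither prover is bound to send well-formed words, and the reduction may output a word that
  encodes no circuit. Both anomalies are folded into the test itself: a block passes only if the
  circuit can be decoded and has exactly twice as many inputs as \<open>x\<close> has bits. Hence
  any nonempty \<open>y\<close> rejects every \<open>x\<close> of the wrong length.

  The reduction is known only through some machine with an unknown number of tapes. The verifier
  carries that machine inside it, with five working tapes inserted behind its first tape: this puts
  \<open>x\<close> and \<open>y\<close> on tapes 1 and 2, where the second and third arguments are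
  placed, and hides them from the simulated machine. Specifications of programs carry explicit step
  bounds, so that correctness and running time are proved together.\<close>

text \<open>\<open>Exit\<close> leaves all enclosing programs up to the next \<open>Try c d\<close>, which then continues with \<open>d\<close>.
  \<open>Run M q\<close> simulates \<open>M\<close> from state \<open>q\<close> on all tapes but the tapes 1 to 5.\<close>

datatype com =
    Skip
  | Exit
  | Op nat "symbol option" move
  | Seq com com  (infixr \<open>;;\<close> 60)
  | Cond nat "symbol \<Rightarrow> bool" com com
  | While nat "symbol \<Rightarrow> bool" com
  | Try com com
  | Run tm nat

definition stay :: "symbol list \<Rightarrow> (symbol \<times> move) list" where
  "stay ss = map (\<lambda>a. (a, Stay)) ss"

text \<open>Control flow costs a step of its own in which the scanned symbols are written back and
  no head moves; this is a source of the additive constants in the time bounds. The simulated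
  machine is shown the symbol of tape 0 followed by those from tape 6 on.\<close>

fun nxt :: "com \<Rightarrow> symbol list \<Rightarrow> com \<times> (symbol \<times> move) list" where
  "nxt Skip ss = (Skip, stay ss)"
| "nxt Exit ss = (Exit, stay ss)"
| "nxt (Op i a m) ss = (Skip, (stay ss)[i := (case a of None \<Rightarrow> ss ! i | Some b \<Rightarrow> b, m)])"
| "nxt (c ;; d) ss =
     (if c = Skip then (d, stay ss) else if c = Exit then (Exit, stay ss)
      else let (c', as) = nxt c ss in (c' ;; d, as))"
| "nxt (Cond i P c d) ss = (if P (ss ! i) then c else d, stay ss)"
| "nxt (While i P c) ss = (if P (ss ! i) then c ;; While i P c else Skip, stay ss)"
| "nxt (Try c d) ss =
     (if c = Skip then (Skip, stay ss) else if c = Exit then (d, stay ss)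
      else let (c', as) = nxt c ss in (Try c' d, as))"
| "nxt (Run M q) ss =
     (if q = halt_state M then (Skip, stay ss)
      else let (q', as) = trans M q (hd ss # drop 6 ss)
           in (Run M q', hd as # stay (take 5 (tl ss)) @ tl as))"

definition com_step :: "com \<times> tape list \<Rightarrow> com \<times> tape list" where
  "com_step = (\<lambda>(c, ts). let (c', as) = nxt c (map (\<lambda>t. t 0) ts) in (c', map2 act as ts))"

text \<open>An over-approximation of the programs that \<open>nxt\<close> can reach. It stays finite
  in spite of loops because an unfolded body is always suspended in front of the same
  \<open>While\<close>; a simulated machine contributes one program for each of its states.\<close>

fun residuals :: "com \<Rightarrow> com set" where
  "residuals Skip = {Skip}"
| "residuals Exit = {Exit}"
| "residuals (Op i a m) = {Op i a m, Skip}"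
| "residuals (c ;; d) = (\<lambda>r. r ;; d) ` residuals c \<union> residuals d \<union> {Exit}"
| "residuals (Cond i P c d) = {Cond i P c d} \<union> residuals c \<union> residuals d"
| "residuals (While i P c) = {While i P c, Skip, Exit} \<union> (\<lambda>r. r ;; While i P c) ` residuals c"
| "residuals (Try c d) = (\<lambda>r. Try r d) ` residuals c \<union> residuals d \<union> {Skip}"
| "residuals (Run M q) = Run M ` states M \<union> {Skip}"

text \<open>For \<open>Run\<close> the alphabets have to agree because \<open>valid_tm\<close>
  controls \<open>trans M\<close> only on symbols of \<open>alphabet M\<close>, while the compiled
  machine may meet any symbol of \<open>A\<close>.\<close>

fun wf_com :: "nat \<Rightarrow> symbol set \<Rightarrow> com \<Rightarrow> bool" where
  "wf_com K A Skip = True"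
| "wf_com K A Exit = True"
| "wf_com K A (Op i a m) = (i < K \<and> (\<forall>b. a = Some b \<longrightarrow> b \<in> A))"
| "wf_com K A (c ;; d) = (wf_com K A c \<and> wf_com K A d)"
| "wf_com K A (Cond i P c d) = (wf_com K A c \<and> wf_com K A d)"
| "wf_com K A (While i P c) = wf_com K A c"
| "wf_com K A (Try c d) = (wf_com K A c \<and> wf_com K A d)"
| "wf_com K A (Run M q) = (valid_tm M \<and> q \<in> states M \<and> alphabet M = A \<and> K = num_tapes M + 5)"

lemma length_stay [simp]: "length (stay ss) = length ss"
  by (simp add: stay_def)

lemma stay_symbols [simp]: "fst ` set (stay ss) = set ss"
  by (force simp: stay_def)

lemma residuals_self: "wf_com K A c \<Longrightarrow> c \<in> residuals c"
  by (induction c) auto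

lemma finite_residuals: "wf_com K A c \<Longrightarrow> finite (residuals c)"
  by (induction c) (auto simp: valid_tm_def)

lemma run_trans:
  assumes "wf_com K A (Run M q)" "q \<noteq> halt_state M" "length ss = K" "set ss \<subseteq> A"
    "trans M q (hd ss # drop 6 ss) = (q', as)"
  shows "q' \<in> states M" "length as = num_tapes M" "fst ` set as \<subseteq> A" "num_tapes M > 0"
proof -
  have "length (hd ss # drop 6 ss) = num_tapes M" "num_tapes M > 0"
    using assms by (auto simp: valid_tm_def)
  moreover have "set (hd ss # drop 6 ss) \<subseteq> alphabet M"
    using assms set_drop_subset[of 6 ss] by (cases ss) auto
  moreover have "q \<in> states M - {halt_state M}" "valid_tm M" using assms by auto
  ultimately have "fst (q', as) \<in> states M \<and> length (snd (q', as)) = num_tapes M \<and>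
      fst ` set (snd (q', as)) \<subseteq> alphabet M"
    unfolding valid_tm_def assms(5)[symmetric] by blast
  then show "q' \<in> states M" "length as = num_tapes M" "fst ` set as \<subseteq> A"
    using assms by auto
  show "num_tapes M > 0" by fact
qed

lemma nxt_wf:
  assumes "wf_com K A c" "length ss = K" "set ss \<subseteq> A" "nxt c ss = (c', as)"
  shows "wf_com K A c' \<and> length as = K \<and> fst ` set as \<subseteq> A"
  using assms
proof (induction c arbitrary: c' as)
  case (Op i a m)
  let ?b = "case a of None \<Rightarrow> ss ! i | Some b \<Rightarrow> b"
  have as: "as = (stay ss)[i := (?b, m)]" using Op.prems by simp
  have "fst ` set as \<subseteq> fst ` insert (?b, m) (set (stay ss))"
    unfolding as by (rule image_mono) (rule set_update_subset_insert)
  then have "fst ` set as \<subseteq> insert ?b (set ss)" by simp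
  moreover have "?b \<in> A"
    using Op.prems by (auto split: option.splits)
  then have "insert ?b (set ss) \<subseteq> A" using Op.prems(3) by simp
  ultimately have "fst ` set as \<subseteq> A" by (rule order_trans)
  moreover have "c' = Skip" using Op.prems(4) by simp
  moreover have "length as = K" unfolding as using Op.prems(2) by simp
  ultimately show ?case by simp
next
  case (Run M q)
  show ?case
  proof (cases "q = halt_state M")
    case True
    then have "c' = Skip" "as = stay ss" using Run.prems(4) by simp_all
    then show ?thesis using Run.prems(2,3) by simp
  next
    case False
    obtain q' bs where t: "trans M q (hd ss # drop 6 ss) = (q', bs)" by fastforce
    note r = run_trans[OF Run(1) False Run(2,3) t]
    have c': "c' = Run M q'" and as: "as = hd bs # stay (take 5 (tl ss)) @ tl bs"
      using Run(4) t False by auto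
    have "bs \<noteq> []" using r by auto
    then have hb: "hd bs \<in> set bs" "set (tl bs) \<subseteq> set bs" by (auto dest: list.set_sel(2))
    have "set (take 5 (tl ss)) \<subseteq> A"
      using Run(3) set_take_subset[of 5 "tl ss"] by (cases ss) auto
    then have "fst ` set as \<subseteq> A"
      using hb r(3) by (auto simp: as image_Un simp del: list.set_sel)
    moreover have "length as = K" using Run r \<open>bs \<noteq> []\<close> by (cases bs) (auto simp: as)
    ultimately show ?thesis using Run(1) r by (simp add: c')
  qed
next
  case (Seq c1 c2)
  obtain r bs where n: "nxt c1 ss = (r, bs)" by fastforce
  have "wf_com K A r \<and> length bs = K \<and> fst ` set bs \<subseteq> A"
    using Seq.IH(1)[OF _ Seq.prems(2,3) n] Seq.prems(1) by simp
  then show ?case using Seq.prems n by (clarsimp split: if_splits)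
next
  case (Try c1 c2)
  obtain r bs where n: "nxt c1 ss = (r, bs)" by fastforce
  have "wf_com K A r \<and> length bs = K \<and> fst ` set bs \<subseteq> A"
    using Try.IH(1)[OF _ Try.prems(2,3) n] Try.prems(1) by simp
  then show ?case using Try.prems n by (clarsimp split: if_splits)
next
  case (Cond i P c1 c2)
  from Cond.prems show ?case by (clarsimp split: if_splits)
next
  case (While i P c)
  from While.prems show ?case by (clarsimp split: if_splits)
qed clarsimp+

text \<open>Closure under \<open>nxt\<close> makes the residuals of the initial program a legitimate
  state set. The induction is on the enclosing program \<open>c\<close> and not on the current
  residual \<open>d\<close>, since the residuals of a loop refer back to the loop.\<close>

lemma nxt_residuals:
  assumes "wf_com K A c" "d \<in> residuals c" "length ss = K" "set ss \<subseteq> A" "nxt d ss = (d', as)"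
  shows "d' \<in> residuals c"
  using assms
proof (induction c arbitrary: d d' as)
  case (Run M q)
  show ?case
  proof (cases "d = Skip \<or> (\<exists>p. d = Run M p \<and> p = halt_state M)")
    case True
    then show ?thesis using Run by auto
  next
    case False
    then obtain p where p: "d = Run M p" "p \<in> states M" "p \<noteq> halt_state M" using Run by auto
    obtain q' bs where t: "trans M p (hd ss # drop 6 ss) = (q', bs)" by fastforce
    have "wf_com K A (Run M p)" using Run p by simp
    from run_trans(1)[OF this p(3) Run(3,4) t] Run(5) t p show ?thesis by auto
  qed
next
  case (Seq c1 c2)
  show ?case
  proof (cases "d \<in> residuals c2 \<union> {Exit}")
    case True
    then show ?thesis using Seq by auto
  next
    case False
    then obtain r where r: "d = r ;; c2" "r \<in> residuals c1" using Seq by auto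
    obtain r' bs where n: "nxt r ss = (r', bs)" by fastforce
    have "r' \<in> residuals c1" using Seq.IH(1)[OF _ r(2) _ _ n] Seq.prems by simp
    then show ?thesis using Seq.prems r n residuals_self[of K A c2]
      by (cases "r = Skip"; cases "r = Exit") auto
  qed
next
  case (Try c1 c2)
  show ?case
  proof (cases "d \<in> residuals c2 \<union> {Skip}")
    case True
    then show ?thesis using Try by auto
  next
    case False
    then obtain r where r: "d = Try r c2" "r \<in> residuals c1" using Try by auto
    obtain r' bs where n: "nxt r ss = (r', bs)" by fastforce
    have "r' \<in> residuals c1" using Try.IH(1)[OF _ r(2) _ _ n] Try.prems by simp
    then show ?thesis using Try.prems r n residuals_self[of K A c2]
      by (cases "r = Skip"; cases "r = Exit") auto
  qed
next
  case (While i P c)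
  show ?case
  proof (cases "d \<in> {While i P c, Skip, Exit}")
    case True
    then show ?thesis using While by (auto split: if_splits simp: residuals_self)
  next
    case False
    then obtain r where r: "d = r ;; While i P c" "r \<in> residuals c" using While by auto
    obtain r' bs where n: "nxt r ss = (r', bs)" by fastforce
    have "r' \<in> residuals c" using While.IH(1)[OF _ r(2) _ _ n] While.prems by simp
    then show ?thesis using While.prems r n
      by (cases "r = Skip"; cases "r = Exit") auto
  qed
next
  case (Cond i P c1 c2)
  show ?case
  proof (cases "d = Cond i P c1 c2")
    case True
    then have "d' = c1 \<or> d' = c2" using Cond.prems by (auto split: if_splits)
    then show ?thesis using residuals_self[of K A] Cond.prems(1) by (metis UnCI residuals.simps(5) wf_com.simps(5))
  next
    case False
    then have "d \<in> residuals c1 \<or> d \<in> residuals c2" using Cond.prems by auto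
    then show ?thesis using Cond.IH(1)[OF _ _ Cond.prems(3-5)] Cond.IH(2)[OF _ _ Cond.prems(3-5)] Cond.prems(1) by auto
  qed
qed auto

lemma residuals_wf: "wf_com K A c \<Longrightarrow> d \<in> residuals c \<Longrightarrow> wf_com K A d"
proof -
  have "wf_com K A c \<longrightarrow> (\<forall>d. d \<in> residuals c \<longrightarrow> wf_com K A d)"
  proof (induction c)
    case (Seq c1 c2)
    have "x \<in> residuals (c1 ;; c2) \<longleftrightarrow> (\<exists>r. r \<in> residuals c1 \<and> x = r ;; c2) \<or> x \<in> residuals c2 \<or> x = Exit" for x
      by auto
    with Seq show ?case using wf_com.simps(2,4) by metis
  next
    case (Cond i P c1 c2)
    have "x \<in> residuals (Cond i P c1 c2) \<longleftrightarrow> x = Cond i P c1 c2 \<or> x \<in> residuals c1 \<or> x \<in> residuals c2" for x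
      by auto
    with Cond show ?case using wf_com.simps(5) by metis
  next
    case (While i P c)
    have "x \<in> residuals (While i P c) \<longleftrightarrow> x = While i P c \<or> x = Skip \<or> x = Exit \<or>
      (\<exists>r. r \<in> residuals c \<and> x = r ;; While i P c)" for x
      by auto
    with While show ?case using wf_com.simps(1,2,4,6) by metis
  next
    case (Try c1 c2)
    have "x \<in> residuals (Try c1 c2) \<longleftrightarrow> (\<exists>r. r \<in> residuals c1 \<and> x = Try r c2) \<or> x \<in> residuals c2 \<or> x = Skip" for x
      by auto
    with Try show ?case using wf_com.simps(1,7) by metis
  qed auto
  then show "wf_com K A c \<Longrightarrow> d \<in> residuals c \<Longrightarrow> wf_com K A d" by blast
qed

text \<open>\<open>Some\<close> stands for normal termination and \<open>None\<close> for an exit,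
  after which the tapes are left open: an exit means rejection, and its handler merely overwrites
  the first tape. Only an upper bound on the number of steps is asserted, so bounds can be rounded
  up freely.\<close>

definition runs :: "com \<Rightarrow> tape list \<Rightarrow> nat \<Rightarrow> tape list option \<Rightarrow> bool" where
  "runs c ts T r \<longleftrightarrow> (\<exists>t \<le> T. case r of
     Some ts' \<Rightarrow> (com_step ^^ t) (c, ts) = (Skip, ts')
   | None \<Rightarrow> \<exists>ts'. (com_step ^^ t) (c, ts) = (Exit, ts'))"

lemma act_range: "range t \<subseteq> A \<Longrightarrow> fst a \<in> A \<Longrightarrow> range (act a t) \<subseteq> A"
  by (cases a; cases "snd a") (auto simp: act_def)

text \<open>The residuals of \<open>c\<close> are numbered injectively; a transition decodes the
  number, applies \<open>nxt\<close> and encodes the result. \<open>Skip\<close> becomes the halting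
  state, and since halting configurations are fixed by \<open>step\<close>, the machine may be
  observed at any time after the program has finished.\<close>

theorem compile:
  assumes wf_com: "wf_com K A c" and K: "K > 0" and A: "finite A" "insert Blank (range Bit) \<subseteq> A"
    and c: "Skip \<in> residuals c"
  obtains N where "valid_tm N" "num_tapes N = K"
    "\<And>ws T ts v. length ws \<le> K \<Longrightarrow>
       runs c (map word_tape ws @ replicate (K - length ws) (word_tape [])) T (Some ts) \<Longrightarrow>
       tape_reads (hd ts) v \<Longrightarrow> yields_within N ws T v"
proof -
  from finite_imp_inj_to_nat_seg[OF finite_residuals[OF wf_com]]
  obtain f :: "com \<Rightarrow> nat" where inj: "inj_on f (residuals c)" by blast
  define g where "g = the_inv_into (residuals c) f"
  have g: "g (f d) = d" if "d \<in> residuals c" for d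
    using that inj by (simp add: g_def the_inv_into_f_f)
  define N where "N = \<lparr>num_tapes = K, states = f ` residuals c, alphabet = A, start_state = f c,
    halt_state = f Skip, trans = (\<lambda>q ss. let (d, as) = nxt (g q) ss in (f d, as))\<rparr>"
  have "valid_tm N"
    unfolding valid_tm_def
  proof (intro conjI ballI allI impI)
    fix q ss assume q: "q \<in> states N - {halt_state N}"
      and ss: "length ss = num_tapes N \<and> set ss \<subseteq> alphabet N"
    obtain d where d: "q = f d" "d \<in> residuals c" using q by (auto simp: N_def)
    obtain d' as where n: "nxt d ss = (d', as)" by fastforce
    have sK: "length ss = K" "set ss \<subseteq> A" using ss by (auto simp: N_def)
    note r = nxt_residuals[OF wf_com d(2) sK n] nxt_wf[OF residuals_wf[OF wf_com d(2)] sK n]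
    have t: "trans N q ss = (f d', as)" by (simp add: N_def g d n)
    show "fst (trans N q ss) \<in> states N" using r by (simp add: t) (simp add: N_def)
    show "length (snd (trans N q ss)) = num_tapes N" using r by (simp add: t) (simp add: N_def)
    show "fst ` set (snd (trans N q ss)) \<subseteq> alphabet N" using r by (simp add: t) (simp add: N_def)
  qed (use assms residuals_self[OF wf_com] finite_residuals[OF wf_com] in \<open>auto simp: N_def\<close>)
  moreover have "num_tapes N = K" by (simp add: N_def)
  moreover have "yields_within N ws T v"
    if len: "length ws \<le> K"
      and run: "runs c (map word_tape ws @ replicate (K - length ws) (word_tape [])) T (Some ts)"
      and reads: "tape_reads (hd ts) v" for ws T ts v
  proof -
    let ?init = "map word_tape ws @ replicate (K - length ws) (word_tape [])"
    \<comment> \<open>The invariant that all cells carry symbols of \<open>A\<close> rides along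
      because closure of the residuals is only known for scanned symbols in
      \<open>A\<close>.\<close>
    have sim: "\<exists>d us. (com_step ^^ t) (c, ?init) = (d, us) \<and> (step N ^^ t) (f c, ?init) = (f d, us)
       \<and> d \<in> residuals c \<and> length us = K \<and> (\<forall>u \<in> set us. range u \<subseteq> A)" for t
    proof (induction t)
      case 0
      have "range (word_tape w) \<subseteq> A" for w using A by (auto simp: word_tape_def)
      then show ?case using len residuals_self[OF wf_com] by (auto split: if_splits simp: image_subset_iff)
    next
      case (Suc t)
      then obtain d us where IH: "(com_step ^^ t) (c, ?init) = (d, us)"
        "(step N ^^ t) (f c, ?init) = (f d, us)" "d \<in> residuals c" "length us = K"
        "\<forall>u \<in> set us. range u \<subseteq> A" by blast
      let ?ss = "map (\<lambda>t. t 0) us"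
      obtain d' as where n: "nxt d ?ss = (d', as)" by fastforce
      have sK: "length ?ss = K" "set ?ss \<subseteq> A" using IH by auto
      note r = nxt_residuals[OF wf_com IH(3) sK n] nxt_wf[OF residuals_wf[OF wf_com IH(3)] sK n]
      have range: "\<forall>u \<in> set (map2 act as us). range u \<subseteq> A"
      proof
        fix u assume "u \<in> set (map2 act as us)"
        then obtain a t where "(a, t) \<in> set (zip as us)" "u = act a t" by auto
        then show "range u \<subseteq> A"
          using IH(5) r(2) by (metis act_range image_subset_iff set_zip_leftD set_zip_rightD)
      qed
      have "step N (f d, us) = (f d', map2 act as us)"
      proof (cases "d = Skip")
        case True
        have "map2 act (stay ?ss) us = us"
          by (rule nth_equalityI) (auto simp: stay_def act_def)
        then show ?thesis using n True by (auto simp: step_def N_def)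
      next
        case False
        \<comment> \<open>Distinct residuals have distinct numbers, so the machine does not halt
          before the program has reached \<open>Skip\<close>.\<close>
        then have "f d \<noteq> f Skip" using inj c IH(3) by (auto dest: inj_onD)
        then show ?thesis by (simp add: step_def N_def g IH(3) n)
      qed
      moreover have "com_step (d, us) = (d', map2 act as us)"
        by (simp add: com_step_def n)
      ultimately show ?case using IH r range by auto
    qed
    obtain t where t: "t \<le> T" "(com_step ^^ t) (c, ?init) = (Skip, ts)"
      using run by (auto simp: runs_def)
    with sim[of t] have 1: "(step N ^^ t) (f c, ?init) = (f Skip, ts)" by auto
    have stop: "(step N ^^ n) (f Skip, ts) = (f Skip, ts)" for n
      by (induction n) (auto simp: step_def N_def)
    have "(step N ^^ T) (f c, ?init) = (step N ^^ (T - t)) ((step N ^^ t) (f c, ?init))"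
      using t(1) by (metis comp_apply funpow_add le_add_diff_inverse2)
    with 1 stop have "(step N ^^ T) (f c, ?init) = (f Skip, ts)" by simp
    moreover have "init_config N ws = (f c, ?init)" by (simp add: init_config_def N_def)
    ultimately show ?thesis using reads by (simp add: yields_within_def N_def)
  qed
  ultimately show thesis by (rule that)
qed

section \<open>Execution of composite programs and its cost\<close>

lemma map2_act_stay [simp]: "map2 act (stay (map (\<lambda>t. t 0) ts)) ts = ts"
  by (rule nth_equalityI) (auto simp: stay_def act_def)

lemma com_step_Skip [simp]: "com_step (Skip, ts) = (Skip, ts)"
  by (simp add: com_step_def)

lemma com_step_Exit [simp]: "com_step (Exit, ts) = (Exit, ts)"
  by (simp add: com_step_def)

lemma com_step_iter_Skip [simp]: "(com_step ^^ t) (Skip, ts) = (Skip, ts)"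
  by (induction t) auto

lemma com_step_iter_Exit [simp]: "(com_step ^^ t) (Exit, ts) = (Exit, ts)"
  by (induction t) auto

lemma com_step_Seq:
  "c \<noteq> Skip \<Longrightarrow> c \<noteq> Exit \<Longrightarrow> com_step (c, ts) = (c', us) \<Longrightarrow>
   com_step (c ;; d, ts) = (c' ;; d, us)"
  by (auto simp: com_step_def split: prod.splits)

lemma com_step_Try:
  "c \<noteq> Skip \<Longrightarrow> c \<noteq> Exit \<Longrightarrow> com_step (c, ts) = (c', us) \<Longrightarrow>
   com_step (Try c d, ts) = (Try c' d, us)"
  by (auto simp: com_step_def split: prod.splits)

text \<open>The sequence may need fewer steps: \<open>c\<close> on its own idles once it has reached
  \<open>Skip\<close> or \<open>Exit\<close>, whereas the sequence would move on to
  \<open>d\<close>, so the idle steps have to be cut off.\<close>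

lemma com_steps_Seq:
  "(com_step ^^ t) (c, ts) = (c', us) \<Longrightarrow> \<exists>t' \<le> t. (com_step ^^ t') (c ;; d, ts) = (c' ;; d, us)"
proof (induction t arbitrary: c ts)
  case (Suc t)
  show ?case
  proof (cases "c = Skip \<or> c = Exit")
    case True
    with Suc.prems show ?thesis by (intro exI[of _ 0]) (auto simp del: funpow.simps)
  next
    case False
    obtain c1 us1 where s: "com_step (c, ts) = (c1, us1)" by fastforce
    with Suc.prems have "(com_step ^^ t) (c1, us1) = (c', us)" by (simp add: funpow_Suc_right del: funpow.simps)
    from Suc.IH[OF this] obtain t' where "t' \<le> t" "(com_step ^^ t') (c1 ;; d, us1) = (c' ;; d, us)" by blast
    with False s show ?thesis
      by (intro exI[of _ "Suc t'"]) (simp add: funpow_Suc_right com_step_Seq del: funpow.simps)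
  qed
qed auto

lemma com_steps_Try:
  "(com_step ^^ t) (c, ts) = (c', us) \<Longrightarrow> \<exists>t' \<le> t. (com_step ^^ t') (Try c d, ts) = (Try c' d, us)"
proof (induction t arbitrary: c ts)
  case (Suc t)
  show ?case
  proof (cases "c = Skip \<or> c = Exit")
    case True
    with Suc.prems show ?thesis by (intro exI[of _ 0]) (auto simp del: funpow.simps)
  next
    case False
    obtain c1 us1 where s: "com_step (c, ts) = (c1, us1)" by fastforce
    with Suc.prems have "(com_step ^^ t) (c1, us1) = (c', us)" by (simp add: funpow_Suc_right del: funpow.simps)
    from Suc.IH[OF this] obtain t' where "t' \<le> t" "(com_step ^^ t') (Try c1 d, us1) = (Try c' d, us)" by blast
    with False s show ?thesis
      by (intro exI[of _ "Suc t'"]) (simp add: funpow_Suc_right com_step_Try del: funpow.simps)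
  qed
qed auto

lemma runs_steps:
  assumes "(com_step ^^ t) (c, ts) = (d, us)" "runs d us T r" "t + T \<le> T'"
  shows "runs c ts T' r"
proof -
  from assms(2) obtain t2 where t2: "t2 \<le> T" "case r of Some ts' \<Rightarrow> (com_step ^^ t2) (d, us) = (Skip, ts')
    | None \<Rightarrow> \<exists>ts'. (com_step ^^ t2) (d, us) = (Exit, ts')"
    by (auto simp: runs_def)
  have "(com_step ^^ (t2 + t)) (c, ts) = (com_step ^^ t2) (d, us)"
    by (simp add: funpow_add assms(1))
  with t2 assms(3) show ?thesis
    unfolding runs_def by (intro exI[of _ "t2 + t"]) (simp split: option.splits)
qed

lemma runs_step: "com_step (c, ts) = (d, us) \<Longrightarrow> runs d us T r \<Longrightarrow> runs c ts (T + 1) r"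
  by (rule runs_steps[where t = 1]) auto

lemma runs_mono: "runs c ts T r \<Longrightarrow> T \<le> T' \<Longrightarrow> runs c ts T' r"
  by (rule runs_steps[where t = 0]) auto

lemma runs_Skip: "runs Skip ts 0 (Some ts)"
  by (auto simp: runs_def)

lemma runs_Exit: "runs Exit ts 0 None"
  by (auto simp: runs_def)

lemma map2_act_update:
  "i < length ts \<Longrightarrow> map2 act ((stay (map (\<lambda>t. t 0) ts))[i := a]) ts = ts[i := act a (ts ! i)]"
  by (rule nth_equalityI) (auto simp: stay_def act_def nth_list_update)

lemma runs_Op:
  assumes "i < length ts"
  shows "runs (Op i a m) ts 1
    (Some (ts[i := act (case a of None \<Rightarrow> (ts ! i) 0 | Some b \<Rightarrow> b, m) (ts ! i)]))"
  using runs_step[of "Op i a m" ts Skip, OF _ runs_Skip] assms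
  by (simp add: com_step_def map2_act_update cong: option.case_cong)

lemma runs_Seq:
  assumes "runs c ts T1 (Some us)" "runs d us T2 r"
  shows "runs (c ;; d) ts (T1 + T2 + 1) r"
proof -
  obtain t where "t \<le> T1" "(com_step ^^ t) (c, ts) = (Skip, us)"
    using assms(1) by (auto simp: runs_def)
  with com_steps_Seq[of t c ts Skip us d]
  obtain t' where "t' \<le> T1" "(com_step ^^ t') (c ;; d, ts) = (Skip ;; d, us)"
    using order_trans by blast
  moreover have "runs (Skip ;; d) us (T2 + 1) r"
    by (rule runs_step[OF _ assms(2)]) (simp add: com_step_def)
  ultimately show ?thesis by (auto intro: runs_steps)
qed

lemma runs_Seq_Exit:
  assumes "runs c ts T None"
  shows "runs (c ;; d) ts (T + 1) None"
proof -
  obtain t us where "t \<le> T" "(com_step ^^ t) (c, ts) = (Exit, us)"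
    using assms by (auto simp: runs_def)
  with com_steps_Seq[of t c ts Exit us d]
  obtain t' where "t' \<le> T" "(com_step ^^ t') (c ;; d, ts) = (Exit ;; d, us)"
    using order_trans by blast
  moreover have "runs (Exit ;; d) us (0 + 1) None"
    by (rule runs_step[OF _ runs_Exit]) (simp add: com_step_def)
  ultimately show ?thesis by (auto intro: runs_steps)
qed

lemma runs_Try:
  assumes "runs c ts T1 (Some us)"
  shows "runs (Try c d) ts (T1 + 1) (Some us)"
proof -
  obtain t where "t \<le> T1" "(com_step ^^ t) (c, ts) = (Skip, us)"
    using assms(1) by (auto simp: runs_def)
  with com_steps_Try[of t c ts Skip us d]
  obtain t' where "t' \<le> T1" "(com_step ^^ t') (Try c d, ts) = (Try Skip d, us)"
    using order_trans by blast
  moreover have "runs (Try Skip d) us (0 + 1) (Some us)"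
    by (rule runs_step[OF _ runs_Skip]) (simp add: com_step_def)
  ultimately show ?thesis by (auto intro: runs_steps)
qed

lemma nxt_nonempty: "ss \<noteq> [] \<Longrightarrow> nxt c ss = (c', as) \<Longrightarrow> as \<noteq> []"
proof (induction c arbitrary: c' as)
  case (Seq c d)
  obtain r bs where n: "nxt c ss = (r, bs)" by fastforce
  from Seq.IH(1)[OF Seq.prems(1) n] Seq.prems n show ?case
    by (auto simp: stay_def split: if_splits)
next
  case (Try c d)
  obtain r bs where n: "nxt c ss = (r, bs)" by fastforce
  from Try.IH(1)[OF Try.prems(1) n] Try.prems n show ?case
    by (auto simp: stay_def split: if_splits)
qed (auto simp: stay_def split: if_splits prod.splits)

text \<open>\<open>map2\<close> truncates to the shorter list, so it has to be excluded that a step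
  loses all tapes. Nonemptiness is all that is known about the tapes after an exit, and it suffices
  for writing the answer.\<close>

lemma com_steps_nonempty:
  "(com_step ^^ t) (c, ts) = (c', us) \<Longrightarrow> ts \<noteq> [] \<Longrightarrow> us \<noteq> []"
proof (induction t arbitrary: c' us)
  case (Suc t)
  obtain d vs where d: "(com_step ^^ t) (c, ts) = (d, vs)" by fastforce
  have vs: "vs \<noteq> []" using Suc.IH[OF d Suc.prems(2)] .
  obtain as where n: "nxt d (map (\<lambda>t. t 0) vs) = (c', as)" and us: "us = map2 act as vs"
    using Suc.prems(1) d by (auto simp: com_step_def split: prod.splits)
  have "as \<noteq> []" using nxt_nonempty[OF _ n] vs by simp
  with us vs show ?case by (cases as; cases vs) auto
qed auto

lemma runs_Try_Exit:
  assumes "runs c ts T1 None" "ts \<noteq> []"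
  obtains us where "us \<noteq> []" "\<And>d T2 r. runs d us T2 r \<Longrightarrow> runs (Try c d) ts (T1 + T2 + 1) r"
proof -
  obtain t us where t: "t \<le> T1" "(com_step ^^ t) (c, ts) = (Exit, us)"
    using assms by (auto simp: runs_def)
  have "runs (Try c d) ts (T1 + T2 + 1) r" if d: "runs d us T2 r" for d T2 r
  proof -
    obtain t' where t': "t' \<le> T1" "(com_step ^^ t') (Try c d, ts) = (Try Exit d, us)"
      using com_steps_Try[OF t(2)] t(1) order_trans by blast
    have "runs (Try Exit d) us (T2 + 1) r"
      by (rule runs_step[OF _ d]) (simp add: com_step_def)
    from runs_steps[OF t'(2) this] t'(1) show ?thesis by simp
  qed
  then show thesis using com_steps_nonempty[OF t(2) assms(2)] that by blast
qed

lemma runs_Cond: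
  assumes "i < length ts" "P ((ts ! i) 0) \<Longrightarrow> runs c ts T r" "\<not> P ((ts ! i) 0) \<Longrightarrow> runs d ts T r"
  shows "runs (Cond i P c d) ts (T + 1) r"
proof -
  have "com_step (Cond i P c d, ts) = (if P ((ts ! i) 0) then c else d, ts)"
    using assms(1) by (simp add: com_step_def)
  then show ?thesis by (rule runs_step) (simp add: assms)
qed

lemma runs_While_stop:
  assumes "i < length ts" "\<not> P ((ts ! i) 0)"
  shows "runs (While i P c) ts 1 (Some ts)"
proof -
  have "com_step (While i P c, ts) = (Skip, ts)"
    using assms by (simp add: com_step_def)
  then show ?thesis using runs_step[OF _ runs_Skip] by fastforce
qed

lemma runs_While_step:
  assumes "i < length ts" "P ((ts ! i) 0)" "runs c ts T1 (Some us)" "runs (While i P c) us T2 r"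
  shows "runs (While i P c) ts (T1 + T2 + 2) r"
proof -
  have "com_step (While i P c, ts) = (c ;; While i P c, ts)"
    using assms by (simp add: com_step_def)
  from runs_step[OF this runs_Seq[OF assms(3,4)]] show ?thesis by simp
qed

lemma runs_While_Exit:
  assumes "i < length ts" "P ((ts ! i) 0)" "runs c ts T None"
  shows "runs (While i P c) ts (T + 2) None"
proof -
  have "com_step (While i P c, ts) = (c ;; While i P c, ts)"
    using assms by (simp add: com_step_def)
  from runs_step[OF this runs_Seq_Exit[OF assms(3)]] show ?thesis by simp
qed

text \<open>The tapes \<open>m\<close> sit between the first and the second tape of \<open>M\<close>
  and never change. \<open>M\<close> may halt before \<open>T\<close> steps are over, which is why
  the halting case reappears in the induction step; the extra step of the bound is the passage from
  the halting state to \<open>Skip\<close>.\<close>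

lemma runs_Run:
  assumes M: "valid_tm M" "q \<in> states M" and m: "length m = 5"
    and us: "length us = num_tapes M" "\<forall>u \<in> set us. range u \<subseteq> alphabet M"
    and run: "(step M ^^ T) (q, us) = (halt_state M, vs)"
  shows "length vs = num_tapes M \<and>
    runs (Run M q) (hd us # m @ tl us) (T + 1) (Some (hd vs # m @ tl vs))"
  using assms(2,4-6)
proof (induction T arbitrary: q us)
  case 0
  have "com_step (Run M q, hd us # m @ tl us) = (Skip, hd vs # m @ tl vs)"
    using 0 map2_act_stay[of "hd us # m @ tl us"]
    by (simp add: com_step_def flip: list.map map_append)
  then show ?case using runs_step[OF _ runs_Skip] 0 by fastforce
next
  case (Suc T)
  show ?case
  proof (cases "q = halt_state M")
    case True
    have "step M (q, us) = (q, us)" using True by (simp add: step_def)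
    then have "(step M ^^ T) (q, us) = (halt_state M, vs)"
      using Suc.prems(4) by (simp add: funpow_Suc_right del: funpow.simps)
    from Suc.IH[OF Suc.prems(1-3) this] show ?thesis
      by (auto intro: runs_mono)
  next
    case False
    let ?ss = "map (\<lambda>t. t 0) us"
    obtain q' as where t: "trans M q ?ss = (q', as)" by fastforce
    have sA: "set ?ss \<subseteq> alphabet M" using Suc.prems(3) by auto
    have "length ?ss = num_tapes M" using Suc.prems(2) by simp
    then have "fst (q', as) \<in> states M \<and> length (snd (q', as)) = num_tapes M \<and>
        fst ` set (snd (q', as)) \<subseteq> alphabet M"
      using M(1) Suc.prems(1) False sA unfolding t[symmetric] valid_tm_def by blast
    then have q': "q' \<in> states M" and as: "length as = num_tapes M" "fst ` set as \<subseteq> alphabet M"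
      by auto
    let ?us = "map2 act as us"
    have "step M (q, us) = (q', ?us)" using False t by (simp add: step_def)
    then have run: "(step M ^^ T) (q', ?us) = (halt_state M, vs)"
      using Suc.prems(4) by (simp add: funpow_Suc_right del: funpow.simps)
    have "\<forall>u \<in> set ?us. range u \<subseteq> alphabet M"
    proof
      fix u assume "u \<in> set ?us"
      then obtain a t where "(a, t) \<in> set (zip as us)" "u = act a t" by auto
      then show "range u \<subseteq> alphabet M"
        using Suc.prems(3) as(2) by (metis act_range image_subset_iff set_zip_leftD set_zip_rightD)
    qed
    from Suc.IH[OF q' _ this run] as Suc.prems(2)
    have IH: "length vs = num_tapes M"
      "runs (Run M q') (hd ?us # m @ tl ?us) (T + 1) (Some (hd vs # m @ tl vs))" by auto
    have pos: "num_tapes M > 0" using M(1) by (simp add: valid_tm_def)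
    obtain u0 ut where u: "us = u0 # ut" using pos Suc.prems(2) by (cases us) auto
    obtain a0 as' where a: "as = a0 # as'" using pos as(1) by (cases as) auto
    have "com_step (Run M q, hd us # m @ tl us) = (Run M q', hd ?us # m @ tl ?us)"
      using t False m by (simp add: com_step_def u a)
    from runs_step[OF this IH(2)] IH(1) show ?thesis by simp
  qed
qed

section \<open>Tapes holding a word\<close>

text \<open>The word on the tape is \<open>e\<close>; its suffix \<open>r\<close> starts at the head.\<close>

definition scan :: "bool list \<Rightarrow> bool list \<Rightarrow> tape" where
  "scan e r = (\<lambda>i. word_tape e (i + int (length e) - int (length r)))"

lemma scan_Nil [simp]: "scan e [] 0 = Blank"
  by (simp add: scan_def word_tape_def)

lemma scan_Cons [simp]: "suffix (a # r) e \<Longrightarrow> scan e (a # r) 0 = Bit a"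
  by (auto simp: suffix_def scan_def word_tape_def nth_append)

lemma act_same [simp]: "act (t 0, m) t = move_head m t"
  by (simp add: act_def)

lemma move_right_scan [simp]: "move_head MoveRight (scan e (a # r)) = scan e r"
  by (simp add: scan_def algebra_simps)

lemma act_right_scan [simp]:
  "suffix (a # r) e \<Longrightarrow> act (Bit a, MoveRight) (scan e (a # r)) = scan e r"
  using act_same[of "scan e (a # r)" MoveRight] by (simp del: act_same move_head.simps)

lemma act_append [simp]:
  "act (Bit b, Stay) (scan e []) = scan (e @ [b]) [b]"
  "act (Bit b, MoveRight) (scan e []) = scan (e @ [b]) []"
  by (auto simp: act_def scan_def word_tape_def fun_eq_iff nth_append nat_eq_iff ac_simps)

lemma act_single [simp]: "act (Bit b, Stay) (scan [c] [c]) = scan [b] [b]"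
  by (auto simp: act_def scan_def word_tape_def fun_eq_iff)

lemma scan_full: "scan e e = word_tape e"
  by (simp add: scan_def)

lemma list_update_Cons_numeral [simp]:
  "(x # xs)[numeral v := y] = x # xs[pred_numeral v := y]"
  by (simp add: numeral_eq_Suc)

definition nonblank :: "symbol \<Rightarrow> bool" where "nonblank s \<longleftrightarrow> s \<noteq> Blank"
definition one :: "symbol \<Rightarrow> bool" where "one s \<longleftrightarrow> s = Bit True"

lemma symbol_tests [simp]: "nonblank (Bit b)" "\<not> nonblank Blank" "one (Bit b) \<longleftrightarrow> b" "\<not> one Blank"
  by (auto simp: nonblank_def one_def)

abbreviation "right i \<equiv> Op i None MoveRight"
abbreviation "left i \<equiv> Op i None MoveLeft"
abbreviation "put i b \<equiv> Op i (Some (Bit b)) Stay"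
abbreviation "put_right i b \<equiv> Op i (Some (Bit b)) MoveRight"

text \<open>The first move to the left is there because the head may stand on the blank behind the
  word, where the loop would stop at once.\<close>

definition "rewind i = left i ;; While i nonblank (left i) ;; right i"

lemma runs_rewind:
  assumes i: "i < length ts" "ts ! i = scan e r" and r: "length r \<le> length e"
  shows "runs (rewind i) ts (3 * length e + 6) (Some (ts[i := scan e e]))"
proof -
  \<comment> \<open>\<open>pos p\<close> puts the head on cell \<open>p\<close> of the word; unlike
    \<open>scan\<close> it also covers the blank cell -1 on which the loop stops.\<close>
  define pos where "pos p = (\<lambda>j. word_tape e (j + p))" for p
  have mv: "move_head MoveLeft (pos p) = pos (p - 1)" "move_head MoveRight (pos p) = pos (p + 1)" for p
    by (auto simp: pos_def algebra_simps)
  have eqs: "scan e r = pos (int (length e - length r))" "scan e e = pos 0"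
    using r by (auto simp: pos_def scan_def of_nat_diff algebra_simps)
  have loop: "runs (While i nonblank (left i)) (ts[i := pos (int n - 1)]) (3 * n + 1) (Some (ts[i := pos (-1)]))"
    if "n \<le> length e" for n
    using that
  proof (induction n)
    case 0
    have "\<not> nonblank ((ts[i := pos (-1)] ! i) 0)" using i by (simp add: pos_def word_tape_def)
    with runs_While_stop[of i "ts[i := pos (-1)]" nonblank] i show ?case by simp
  next
    case (Suc n)
    have nb: "nonblank ((ts[i := pos (int (Suc n) - 1)] ! i) 0)"
      using i Suc.prems by (simp add: pos_def word_tape_def)
    have "runs (left i) (ts[i := pos (int (Suc n) - 1)]) 1 (Some (ts[i := pos (int n - 1)]))"
      using runs_Op[of i "ts[i := pos (int (Suc n) - 1)]" None MoveLeft] i by (simp add: mv del: move_head.simps)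
    with runs_While_step[of i "ts[i := pos (int (Suc n) - 1)]" nonblank, OF _ nb this Suc.IH] Suc.prems i
    show ?case by (auto intro: runs_mono)
  qed
  have a: "runs (left i) ts 1 (Some (ts[i := pos (int (length e - length r) - 1)]))"
    using runs_Op[of i ts None MoveLeft] i by (simp add: eqs mv del: move_head.simps)
  have b: "runs (right i) (ts[i := pos (-1)]) 1 (Some (ts[i := scan e e]))"
    using runs_Op[of i "ts[i := pos (-1)]" None MoveRight] i by (simp add: mv eqs del: move_head.simps)
  have l: "length e - length r \<le> length e" by simp
  from runs_Seq[OF a runs_Seq[OF loop[OF l] b]] show ?thesis
    unfolding rewind_def by (rule runs_mono) simp
qed

lemma scan_drop [simp]: "i < length vs \<Longrightarrow> scan vs (drop i vs) 0 = Bit (vs ! i)"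
  by (simp add: scan_Cons suffix_drop flip: Cons_nth_drop_Suc) (metis Cons_nth_drop_Suc scan_Cons suffix_drop)

lemma runs_seek:
  assumes "i < length ts" "suffix u e" "ts ! i = scan e u"
  shows "runs (While i nonblank (right i)) ts (3 * length u + 1) (Some (ts[i := scan e []]))"
  using assms
proof (induction u arbitrary: ts)
  case Nil
  have "runs (While i nonblank (right i)) ts 1 (Some ts)"
    using Nil by (intro runs_While_stop) auto
  then show ?case using Nil by (metis list_update_id list.size(3) mult_0_right add_0)
next
  case (Cons a u)
  have nb: "nonblank ((ts ! i) 0)" using Cons by simp
  have s: "runs (right i) ts 1 (Some (ts[i := scan e u]))"
    using runs_Op[of i ts None MoveRight] Cons.prems by (simp del: move_head.simps)
  have "runs (While i nonblank (right i)) (ts[i := scan e u]) (3 * length u + 1) (Some (ts[i := scan e []]))"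
    using Cons.IH[of "ts[i := scan e u]"] Cons.prems suffix_ConsD by fastforce
  from runs_While_step[OF Cons.prems(1) nb s this] show ?case by (rule runs_mono) simp
qed

section \<open>Decoding unary numbers\<close>

definition unary :: "bool list \<Rightarrow> (nat \<times> bool list) option" where
  "unary r = (case dropWhile (\<lambda>b. b) r of [] \<Rightarrow> None | _ # r' \<Rightarrow> Some (length (takeWhile (\<lambda>b. b) r), r'))"

lemma unary_Some: "unary r = Some (i, r') \<longleftrightarrow> r = enc_nat i @ r'"
proof
  assume "unary r = Some (i, r')"
  then obtain b where b: "dropWhile (\<lambda>b. b) r = b # r'" "i = length (takeWhile (\<lambda>b. b) r)"
    by (auto simp: unary_def split: list.splits)
  have "takeWhile (\<lambda>b. b) r = replicate i True"
    unfolding b(2) by (rule replicate_eqI) (auto dest: set_takeWhileD)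
  moreover have "\<not> b" using b(1) hd_dropWhile[of "\<lambda>b. b" r] by auto
  ultimately show "r = enc_nat i @ r'" using takeWhile_dropWhile_id[of "\<lambda>b. b" r] b(1)
    by (auto simp: enc_nat_def)
next
  have "takeWhile (\<lambda>b. b) (enc_nat i @ r') = replicate i True" "dropWhile (\<lambda>b. b) (enc_nat i @ r') = False # r'"
    by (induction i) (auto simp: enc_nat_def)
  then show "r = enc_nat i @ r' \<Longrightarrow> unary r = Some (i, r')" by (simp add: unary_def)
qed

lemma unary_suffix: "unary r = Some (i, r') \<Longrightarrow> suffix r' r"
  by (auto simp: unary_Some suffix_def)

lemma unary_length: "unary r = Some (i, r') \<Longrightarrow> length r' < length r"
  by (auto simp: unary_Some enc_nat_def)

section \<open>Evaluating an encoded circuit\<close>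

text \<open>Tape 1 holds \<open>x\<close>, tape 2 holds \<open>y\<close>, tape 3 the encoded circuit and tape 4 the wire values computed
  so far; tape 5 records whether the current block of \<open>y\<close> differs from \<open>x\<close>. Running off the
  end of tape 4 while counting down a wire number means that the gate is not valid.\<close>

definition "walk = While 3 one (Cond 4 nonblank (right 3 ;; right 4) Exit)"

text \<open>Both heads advance once per leading one. If the count equals the length of
  \<open>u\<close>, the walk succeeds with tape 4 on the blank behind the wire values; the caller
  decides whether this is an error (\<open>fetch\<close>) or the desired outcome
  (\<open>check_inputs\<close>).\<close>

lemma runs_walk:
  assumes "suffix r e" "suffix u vs"
  shows "runs walk (t0 # x # y # scan e r # scan vs u # f # rest) (6 * length r + 4)
    (if length (takeWhile (\<lambda>b. b) r) \<le> length u
     then Some (t0 # x # y # scan e (dropWhile (\<lambda>b. b) r) # scan vs (drop (length (takeWhile (\<lambda>b. b) r)) u) # f # rest)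
     else None)"
  using assms
proof (induction r arbitrary: u)
  case Nil
  let ?ts = "t0 # x # y # scan e [] # scan vs u # f # rest"
  have "runs walk ?ts 1 (Some ?ts)" unfolding walk_def by (rule runs_While_stop) simp_all
  then show ?case by (auto intro: runs_mono)
next
  case (Cons a r)
  let ?ts = "\<lambda>e w. t0 # x # y # e # w # f # rest"
  show ?case
  proof (cases a)
    case False
    then have "runs walk (?ts (scan e (a # r)) (scan vs u)) 1 (Some (?ts (scan e (a # r)) (scan vs u)))"
      unfolding walk_def using Cons.prems by (intro runs_While_stop) simp_all
    then show ?thesis using False by (auto intro: runs_mono)
  next
    case True
    have one: "one ((?ts (scan e (a # r)) (scan vs u) ! 3) 0)" using Cons.prems True by simp
    show ?thesis
    proof (cases u)
      case Nil
      have "runs (Cond 4 nonblank (right 3 ;; right 4) Exit) (?ts (scan e (a # r)) (scan vs u)) (0 + 1) None"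
        by (rule runs_Cond) (simp_all add: Nil runs_Exit)
      from runs_While_Exit[where P = one, OF _ one this] show ?thesis
        using True Nil by (auto simp: walk_def intro: runs_mono)
    next
      case (Cons b u')
      have 1: "runs (right 3) (?ts (scan e (a # r)) (scan vs (b # u'))) 1
          (Some (?ts (scan e r) (scan vs (b # u'))))"
        using runs_Op[of 3 "?ts (scan e (a # r)) (scan vs (b # u'))" None MoveRight]
        by (simp del: move_head.simps)
      have 2: "runs (right 4) (?ts (scan e r) (scan vs (b # u'))) 1 (Some (?ts (scan e r) (scan vs u')))"
        using runs_Op[of 4 "?ts (scan e r) (scan vs (b # u'))" None MoveRight]
        by (simp del: move_head.simps)
      have s: "runs (Cond 4 nonblank (right 3 ;; right 4) Exit) (?ts (scan e (a # r)) (scan vs u))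
          (1 + 1 + 1 + 1) (Some (?ts (scan e r) (scan vs u')))"
        using runs_Seq[OF 1 2] Cons Cons.prems(2) \<open>suffix u vs\<close> by (intro runs_Cond) simp_all
      have suf: "suffix r e" "suffix u' vs" using Cons.prems Cons suffix_ConsD by fastforce+
      from runs_While_step[where P = one, OF _ one s, folded walk_def, OF _ Cons.IH[OF suf]] show ?thesis
        using True Cons by (auto intro: runs_mono)
    qed
  qed
qed

text \<open>Used after a run of ones, where a nonblank cell can only hold the terminating
  \<open>False\<close>; a blank means that the word broke off inside a number.\<close>

definition "accept_bit = Cond 3 nonblank (right 3) Exit"

lemma runs_accept_bit:
  assumes "suffix r e"
  shows "runs accept_bit (t0 # x # y # scan e r # rest) 2
    (case r of [] \<Rightarrow> None | a # r' \<Rightarrow> Some (t0 # x # y # scan e r' # rest))"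
proof (cases r)
  case Nil
  then have "runs accept_bit (t0 # x # y # scan e r # rest) (0 + 1) None"
    unfolding accept_bit_def by (intro runs_Cond) (simp_all add: runs_Exit)
  then show ?thesis using Nil by (auto intro: runs_mono)
next
  case (Cons a r')
  have "runs (right 3) (t0 # x # y # scan e r # rest) 1 (Some (t0 # x # y # scan e r' # rest))"
    using runs_Op[of 3 "t0 # x # y # scan e r # rest" None MoveRight] Cons
    by (simp del: move_head.simps)
  then have "runs accept_bit (t0 # x # y # scan e r # rest) (1 + 1) (Some (t0 # x # y # scan e r' # rest))"
    unfolding accept_bit_def using Cons assms by (intro runs_Cond) simp_all
  then show ?thesis using Cons by (auto intro: runs_mono)
qed

definition "skip_unary = While 3 one (right 3) ;; accept_bit"

lemma runs_skip_unary:
  assumes "suffix r e"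
  shows "runs skip_unary (t0 # x # y # scan e r # rest) (3 * length r + 4)
    (map_option (\<lambda>(i, r'). t0 # x # y # scan e r' # rest) (unary r))"
proof -
  let ?ts = "\<lambda>r. t0 # x # y # scan e r # rest"
  have loop: "runs (While 3 one (right 3)) (?ts r) (3 * length r + 1) (Some (?ts (dropWhile (\<lambda>b. b) r)))"
    using assms
  proof (induction r)
    case (Cons a r)
    show ?case
    proof (cases a)
      case True
      have one: "one ((?ts (a # r) ! 3) 0)" using Cons.prems True by simp
      have "runs (right 3) (?ts (a # r)) 1 (Some (?ts r))"
        using runs_Op[of 3 "?ts (a # r)" None MoveRight] by (simp del: move_head.simps)
      from runs_While_step[where P = one, OF _ one this Cons.IH[OF suffix_ConsD[OF Cons.prems]]] True
      show ?thesis by (auto intro: runs_mono)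
    next
      case False
      have "runs (While 3 one (right 3)) (?ts (a # r)) 1 (Some (?ts (a # r)))"
        using Cons.prems False by (intro runs_While_stop) simp_all
      then show ?thesis using False by (auto intro: runs_mono)
    qed
  next
    case Nil
    have "runs (While 3 one (right 3)) (?ts []) 1 (Some (?ts []))" by (rule runs_While_stop) simp_all
    then show ?case by simp
  qed
  have suf: "suffix (dropWhile (\<lambda>b. b) r) e"
    using assms suffix_dropWhile suffix_order.trans by blast
  have "runs skip_unary (?ts r) ((3 * length r + 1) + 2 + 1)
      (case dropWhile (\<lambda>b. b) r of [] \<Rightarrow> None | a # r' \<Rightarrow> Some (?ts r'))"
    unfolding skip_unary_def by (rule runs_Seq[OF loop runs_accept_bit[OF suf]])
  moreover have "map_option (\<lambda>(i, r'). ?ts r') (unary r) =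
      (case dropWhile (\<lambda>b. b) r of [] \<Rightarrow> None | a # r' \<Rightarrow> Some (?ts r'))"
    unfolding unary_def
    by (cases "dropWhile (\<lambda>b. b) r") (simp_all del: dropWhile_eq_Nil_conv)
  ultimately have "runs skip_unary (?ts r) ((3 * length r + 1) + 2 + 1)
      (map_option (\<lambda>(i, r'). ?ts r') (unary r))" by (simp only:)
  then show ?thesis by (rule runs_mono) simp
qed

definition fetched :: "bool list \<Rightarrow> bool list \<Rightarrow> (nat \<times> bool list) option" where
  "fetched vs r = Option.bind (unary r) (\<lambda>(i, r'). if i < length vs then Some (i, r') else None)"

lemma fetched_Some: "fetched vs r = Some (i, r') \<longleftrightarrow> unary r = Some (i, r') \<and> i < length vs"
  by (auto simp: fetched_def bind_eq_Some_conv split: if_splits)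

text \<open>The last test excludes a wire number equal to the number of wires, which
  \<open>walk\<close> lets through.\<close>

definition "fetch = rewind 4 ;; walk ;; accept_bit ;; Cond 4 nonblank Skip Exit"

lemma runs_fetch:
  assumes "suffix r e" "suffix u vs"
  shows "runs fetch (t0 # x # y # scan e r # scan vs u # f # rest) (3 * length vs + 6 * length r + 16)
    (map_option (\<lambda>(i, r'). t0 # x # y # scan e r' # scan vs (drop i vs) # f # rest) (fetched vs r))"
proof -
  let ?ts = "\<lambda>r u. t0 # x # y # scan e r # scan vs u # f # rest"
  let ?k = "length (takeWhile (\<lambda>b. b) r)" and ?d = "dropWhile (\<lambda>b. b) r"
  have rew: "runs (rewind 4) (?ts r u) (3 * length vs + 6) (Some (?ts r vs))"
    using runs_rewind[of 4 "?ts r u" vs u] suffix_length_le[OF assms(2)] by simp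
  have wk: "runs walk (?ts r vs) (6 * length r + 4)
      (if ?k \<le> length vs then Some (?ts ?d (drop ?k vs)) else None)"
    using runs_walk[of r e vs vs] assms(1) by simp
  have suf: "suffix ?d e" using assms(1) suffix_dropWhile suffix_order.trans by blast
  have "runs (walk ;; accept_bit ;; Cond 4 nonblank Skip Exit) (?ts r vs) (6 * length r + 4 + (2 + 1 + 1) + 1)
     (map_option (\<lambda>(i, r'). ?ts r' (drop i vs)) (fetched vs r))"
  proof (cases "?k \<le> length vs")
    case False
    then have "fetched vs r = None" by (auto simp: fetched_def unary_def split: list.splits)
    moreover have "runs (walk ;; accept_bit ;; Cond 4 nonblank Skip Exit) (?ts r vs) (6 * length r + 4 + 1) None"
      using wk False by (intro runs_Seq_Exit) simp
    ultimately show ?thesis by (auto intro: runs_mono)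
  next
    case True
    then have wk': "runs walk (?ts r vs) (6 * length r + 4) (Some (?ts ?d (drop ?k vs)))"
      using wk by simp
    have acc: "runs accept_bit (?ts ?d (drop ?k vs)) 2
        (case ?d of [] \<Rightarrow> None | a # r' \<Rightarrow> Some (?ts r' (drop ?k vs)))"
      by (rule runs_accept_bit[OF suf])
    show ?thesis
    proof (cases ?d)
      case Nil
      from acc have "runs accept_bit (?ts ?d (drop ?k vs)) 2 None" unfolding Nil by simp
      then have "runs (accept_bit ;; Cond 4 nonblank Skip Exit) (?ts ?d (drop ?k vs)) (2 + 1) None"
        by (rule runs_Seq_Exit)
      note r = runs_Seq[OF wk' this]
      have "fetched vs r = None" unfolding fetched_def unary_def Nil by simp
      then show ?thesis using runs_mono[OF r] by simp
    next
      case (Cons a r')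
      have fin: "runs (Cond 4 nonblank Skip Exit) (?ts r' (drop ?k vs)) (0 + 1)
          (if ?k < length vs then Some (?ts r' (drop ?k vs)) else None)"
        using True by (intro runs_Cond) (auto intro: runs_Skip runs_Exit simp: not_less)
      from acc Cons have "runs accept_bit (?ts ?d (drop ?k vs)) 2 (Some (?ts r' (drop ?k vs)))" by simp
      note r = runs_Seq[OF wk' runs_Seq[OF this fin]]
      have "fetched vs r = (if ?k < length vs then Some (?k, r') else None)"
        unfolding fetched_def unary_def Cons by simp
      then show ?thesis using runs_mono[OF r] by (cases "?k < length vs") simp_all
    qed
  qed
  from runs_Seq[OF rew this] show ?thesis unfolding fetch_def by (rule runs_mono) simp
qed

definition "push b = While 4 nonblank (right 4) ;; put 4 b"

lemma runs_push:
  assumes "suffix u vs"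
  shows "runs (push b) (t0 # x # y # e # scan vs u # f # rest) (3 * length vs + 3)
    (Some (t0 # x # y # e # scan (vs @ [b]) [b] # f # rest))"
proof -
  let ?ts = "\<lambda>w. t0 # x # y # e # w # f # rest"
  have 1: "runs (While 4 nonblank (right 4)) (?ts (scan vs u)) (3 * length u + 1) (Some (?ts (scan vs [])))"
    using runs_seek[of 4 "?ts (scan vs u)" u vs] assms by simp
  have 2: "runs (put 4 b) (?ts (scan vs [])) 1 (Some (?ts (scan (vs @ [b]) [b])))"
    using runs_Op[of 4 "?ts (scan vs [])" "Some (Bit b)" Stay] by simp
  from runs_Seq[OF 1 2] suffix_length_le[OF assms] show ?thesis
    unfolding push_def by (auto intro: runs_mono)
qed

lemma runs_Op_bit:
  "runs (right 3) (t0 # x # y # scan e (a # r) # rest) 1 (Some (t0 # x # y # scan e r # rest))"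
  using runs_Op[of 3 "t0 # x # y # scan e (a # r) # rest" None MoveRight]
  by (simp del: move_head.simps scan_Cons)

text \<open>The value of the first operand is remembered in the control state: the code for the
  second operand exists once for each value, so that no tape has to store it.\<close>

definition "push_binary h =
  fetch ;; Cond 4 one (fetch ;; Cond 4 one (push (h True True)) (push (h True False)))
                    (fetch ;; Cond 4 one (push (h False True)) (push (h False False)))"

lemma runs_push_binary:
  assumes "suffix r e" "suffix u vs"
  shows "runs (push_binary h) (t0 # x # y # scan e r # scan vs u # f # rest)
    (9 * length vs + 12 * length r + 39)
    (Option.bind (fetched vs r) (\<lambda>(i, r1). map_option (\<lambda>(j, r2).
       t0 # x # y # scan e r2 # scan (vs @ [h (vs ! i) (vs ! j)]) [h (vs ! i) (vs ! j)] # f # rest)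
       (fetched vs r1)))"
proof -
  let ?ts = "\<lambda>r w. t0 # x # y # scan e r # w # f # rest"
  note f1 = runs_fetch[OF assms, of t0 x y f rest]
  show ?thesis
  proof (cases "fetched vs r")
    case None
    then have "runs (push_binary h) (?ts r (scan vs u)) (3 * length vs + 6 * length r + 16 + 1) None"
      unfolding push_binary_def using f1 by (intro runs_Seq_Exit) simp
    from runs_mono[OF this] None show ?thesis by simp
  next
    case (Some p)
    obtain i r1 where p: "p = (i, r1)" by fastforce
    then have i: "i < length vs" "unary r = Some (i, r1)" using Some by (auto simp: fetched_Some)
    have suf: "suffix r1 e" using unary_suffix[OF i(2)] assms(1) suffix_order.trans by blast
    have len: "length r1 < length r" using unary_length[OF i(2)] .
    note f2 = runs_fetch[OF suf suffix_drop[of i vs], of t0 x y f rest]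
    let ?T = "3 * length vs + 6 * length r1 + 16 + (3 * length vs + 3 + 1) + 1"
    have "runs (fetch ;; Cond 4 one (push (h a True)) (push (h a False))) (?ts r1 (scan vs (drop i vs))) ?T
        (map_option (\<lambda>(j, r2). ?ts r2 (scan (vs @ [h a (vs ! j)]) [h a (vs ! j)])) (fetched vs r1))" for a
    proof (cases "fetched vs r1")
      case None
      then have "runs (fetch ;; Cond 4 one (push (h a True)) (push (h a False))) (?ts r1 (scan vs (drop i vs)))
          (3 * length vs + 6 * length r1 + 16 + 1) None"
        using f2 by (intro runs_Seq_Exit) simp
      from runs_mono[OF this] None show ?thesis by simp
    next
      case (Some q)
      obtain j r2 where q: "q = (j, r2)" by fastforce
      then have j: "j < length vs" using Some by (auto simp: fetched_Some)
      have f2': "runs fetch (?ts r1 (scan vs (drop i vs))) (3 * length vs + 6 * length r1 + 16)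
          (Some (?ts r2 (scan vs (drop j vs))))"
        using f2 Some q by simp
      have "runs (Cond 4 one (push (h a True)) (push (h a False))) (?ts r2 (scan vs (drop j vs)))
          (3 * length vs + 3 + 1) (Some (?ts r2 (scan (vs @ [h a (vs ! j)]) [h a (vs ! j)])))"
        by (rule runs_Cond) (use runs_push[OF suffix_drop[of j vs], of _ t0 x y _ f rest] j in \<open>auto\<close>)
      from runs_Seq[OF f2' this] show ?thesis using Some q by simp
    qed
    note b = this[of True] this[of False]
    have "runs (Cond 4 one (fetch ;; Cond 4 one (push (h True True)) (push (h True False)))
                    (fetch ;; Cond 4 one (push (h False True)) (push (h False False))))
        (?ts r1 (scan vs (drop i vs))) (?T + 1)
        (map_option (\<lambda>(j, r2). ?ts r2 (scan (vs @ [h (vs ! i) (vs ! j)]) [h (vs ! i) (vs ! j)])) (fetched vs r1))"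
      by (rule runs_Cond) (use b i in \<open>simp_all\<close>)
    note r = runs_Seq[OF _ this, of fetch]
    have "runs fetch (?ts r (scan vs u)) (3 * length vs + 6 * length r + 16)
        (Some (?ts r1 (scan vs (drop i vs))))"
      using f1 Some p by simp
    from runs_mono[OF r[OF this]] len Some p show ?thesis by (simp add: push_binary_def)
  qed
qed

definition "push_not = fetch ;; Cond 4 one (push False) (push True)"

lemma runs_push_not:
  assumes "suffix r e" "suffix u vs"
  shows "runs push_not (t0 # x # y # scan e r # scan vs u # f # rest) (6 * length vs + 6 * length r + 21)
    (map_option (\<lambda>(i, r1). t0 # x # y # scan e r1 # scan (vs @ [\<not> vs ! i]) [\<not> vs ! i] # f # rest)
       (fetched vs r))"
proof -
  let ?ts = "\<lambda>r w. t0 # x # y # scan e r # w # f # rest"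
  note f1 = runs_fetch[OF assms, of t0 x y f rest]
  show ?thesis
  proof (cases "fetched vs r")
    case None
    then have "runs push_not (?ts r (scan vs u)) (3 * length vs + 6 * length r + 16 + 1) None"
      unfolding push_not_def using f1 by (intro runs_Seq_Exit) simp
    from runs_mono[OF this] None show ?thesis by simp
  next
    case (Some q)
    obtain j r2 where q: "q = (j, r2)" by fastforce
    then have j: "j < length vs" using Some by (auto simp: fetched_Some)
    have f1': "runs fetch (?ts r (scan vs u)) (3 * length vs + 6 * length r + 16)
        (Some (?ts r2 (scan vs (drop j vs))))"
      using f1 Some q by simp
    have "runs (Cond 4 one (push False) (push True)) (?ts r2 (scan vs (drop j vs)))
        (3 * length vs + 3 + 1) (Some (?ts r2 (scan (vs @ [\<not> vs ! j]) [\<not> vs ! j])))"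
      by (rule runs_Cond) (use runs_push[OF suffix_drop[of j vs], of _ t0 x y _ f rest] j in \<open>auto\<close>)
    from runs_mono[OF runs_Seq[OF f1' this]] Some q show ?thesis by (simp add: push_not_def)
  qed
qed

section \<open>Parsing and evaluating the list of gates\<close>

fun parse_gate :: "bool list \<Rightarrow> (gate \<times> bool list) option" where
  "parse_gate (False # False # b # r) = Some (ConstGate b, r)"
| "parse_gate (False # True # r) = map_option (\<lambda>(i, r'). (NotGate i, r')) (unary r)"
| "parse_gate (True # c # r) = Option.bind (unary r) (\<lambda>(i, r'). map_option
     (\<lambda>(j, r''). (if c then OrGate i j else AndGate i j, r'')) (unary r'))"
| "parse_gate _ = None"

definition gate_step :: "bool list \<Rightarrow> bool list \<Rightarrow> (bool \<times> bool list) option" where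
  "gate_step vs r = Option.bind (parse_gate r) (\<lambda>(g, r').
     if operands g \<subseteq> {..<length vs} then Some (gate_value vs g, r') else None)"

definition "run_gate =
  Cond 3 one
    (right 3 ;; Cond 3 nonblank Skip Exit ;;
     Cond 3 one (right 3 ;; push_binary (\<or>)) (right 3 ;; push_binary (\<and>)))
    (right 3 ;; Cond 3 nonblank Skip Exit ;;
     Cond 3 one (right 3 ;; push_not)
       (right 3 ;; Cond 3 nonblank Skip Exit ;;
        Cond 3 one (right 3 ;; push True) (right 3 ;; push False)))"

lemma runs_nonblank:
  assumes "suffix r e" "\<And>b r'. r = b # r' \<Longrightarrow> runs c (t0 # x # y # scan e (b # r') # rest) T res"
    "r = [] \<Longrightarrow> res = None"
  shows "runs (Cond 3 nonblank Skip Exit ;; c) (t0 # x # y # scan e r # rest) (T + 2) res"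
proof (cases r)
  case Nil
  have "runs (Cond 3 nonblank Skip Exit) (t0 # x # y # scan e r # rest) (0 + 1) None"
    using Nil by (intro runs_Cond) (simp_all add: runs_Exit)
  from runs_mono[OF runs_Seq_Exit[OF this]] Nil assms(3) show ?thesis by simp
next
  case (Cons b r')
  have "runs (Cond 3 nonblank Skip Exit) (t0 # x # y # scan e (b # r') # rest) (0 + 1)
      (Some (t0 # x # y # scan e (b # r') # rest))"
    using Cons assms(1) by (intro runs_Cond) (simp_all add: runs_Skip)
  from runs_mono[OF runs_Seq[OF this assms(2)[OF Cons]]] Cons show ?thesis by simp
qed

lemma runs_branch:
  assumes "suffix (b # r) e"
    "b \<Longrightarrow> runs c (t0 # x # y # scan e r # rest) T res"
    "\<not> b \<Longrightarrow> runs d (t0 # x # y # scan e r # rest) T res"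
  shows "runs (Cond 3 one (right 3 ;; c) (right 3 ;; d)) (t0 # x # y # scan e (b # r) # rest) (T + 3) res"
proof -
  have "runs (Cond 3 one (right 3 ;; c) (right 3 ;; d)) (t0 # x # y # scan e (b # r) # rest) (1 + T + 1 + 1) res"
    by (rule runs_Cond)
      (use assms(1) runs_Seq[OF runs_Op_bit assms(2)] runs_Seq[OF runs_Op_bit assms(3)] in simp_all)
  then show ?thesis by (rule runs_mono) simp
qed

lemma runs_run_gate:
  assumes "suffix (a # r) e" "suffix u vs"
  shows "runs run_gate (t0 # x # y # scan e (a # r) # scan vs u # f # rest)
    (9 * length vs + 12 * length r + 52)
    (map_option (\<lambda>(b, r'). t0 # x # y # scan e r' # scan (vs @ [b]) [b] # f # rest)
       (gate_step vs (a # r)))"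
proof -
  let ?ts = "\<lambda>r w. t0 # x # y # scan e r # w # f # rest"
  let ?T = "9 * length vs + 12 * length r + 39"
  have suf: "suffix r e" using assms(1) by (rule suffix_ConsD)
  have pos: "runs (Cond 3 nonblank Skip Exit ;;
      Cond 3 one (right 3 ;; push_binary (\<or>)) (right 3 ;; push_binary (\<and>))) (?ts r (scan vs u)) (?T + 3 + 2)
      (map_option (\<lambda>(b, r'). ?ts r' (scan (vs @ [b]) [b])) (gate_step vs (True # r)))"
  proof (rule runs_nonblank[OF suf])
    fix c r' assume r: "r = c # r'"
    have s1: "suffix (c # r') e" using suf r by simp
    have s2: "suffix r' e" using s1 by (rule suffix_ConsD)
    let ?h = "if c then (\<or>) else (\<and>)"
    \<comment> \<open>The machine checks the first operand before it reads the second, while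
      \<open>gate_step\<close> parses the entire gate first. Both orders fail on the same words, so
      the outcomes agree.\<close>
    have "map_option (\<lambda>(b, r'). ?ts r' (scan (vs @ [b]) [b])) (gate_step vs (True # c # r')) =
       (Option.bind (fetched vs r') (\<lambda>(i, r1). map_option (\<lambda>(j, r2).
          ?ts r2 (scan (vs @ [?h (vs ! i) (vs ! j)]) [?h (vs ! i) (vs ! j)])) (fetched vs r1)))"
      by (auto simp: gate_step_def fetched_def split: option.splits if_splits bind_split)
    moreover have "runs (push_binary ?h) (?ts r' (scan vs u)) ?T
       (Option.bind (fetched vs r') (\<lambda>(i, r1). map_option (\<lambda>(j, r2).
          ?ts r2 (scan (vs @ [?h (vs ! i) (vs ! j)]) [?h (vs ! i) (vs ! j)])) (fetched vs r1)))"
      by (rule runs_mono[OF runs_push_binary[OF s2 assms(2)]]) (simp add: r)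
    ultimately have "runs (push_binary ?h) (?ts r' (scan vs u)) ?T
      (map_option (\<lambda>(b, r'). ?ts r' (scan (vs @ [b]) [b])) (gate_step vs (True # r)))"
      by (simp only: r)
    then show "runs (Cond 3 one (right 3 ;; push_binary (\<or>)) (right 3 ;; push_binary (\<and>)))
      (?ts (c # r') (scan vs u)) (?T + 3)
      (map_option (\<lambda>(b, r'). ?ts r' (scan (vs @ [b]) [b])) (gate_step vs (True # r)))"
      by (intro runs_branch[OF s1]) simp_all
  qed (simp add: gate_step_def)
  have const: "runs (Cond 3 nonblank Skip Exit ;; Cond 3 one (right 3 ;; push True) (right 3 ;; push False))
      (?ts q (scan vs u)) (3 * length vs + 3 + 3 + 2)
      (map_option (\<lambda>(b, r'). ?ts r' (scan (vs @ [b]) [b])) (gate_step vs (False # False # q)))"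
    if q: "suffix q e" for q
  proof (rule runs_nonblank[OF q])
    fix b q' assume b: "q = b # q'"
    have s1: "suffix (b # q') e" using q b by simp
    have "runs (push b) (?ts q' (scan vs u)) (3 * length vs + 3) (Some (?ts q' (scan (vs @ [b]) [b])))"
      by (rule runs_push[OF assms(2)])
    then show "runs (Cond 3 one (right 3 ;; push True) (right 3 ;; push False)) (?ts (b # q') (scan vs u))
        (3 * length vs + 3 + 3)
        (map_option (\<lambda>(b, r'). ?ts r' (scan (vs @ [b]) [b])) (gate_step vs (False # False # q)))"
      by (intro runs_branch[OF s1]) (simp_all add: b gate_step_def)
  qed (simp add: gate_step_def)
  have neg: "runs (Cond 3 nonblank Skip Exit ;;
      Cond 3 one (right 3 ;; push_not)
       (right 3 ;; Cond 3 nonblank Skip Exit ;;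
        Cond 3 one (right 3 ;; push True) (right 3 ;; push False))) (?ts r (scan vs u)) (?T + 3 + 2)
      (map_option (\<lambda>(b, r'). ?ts r' (scan (vs @ [b]) [b])) (gate_step vs (False # r)))"
  proof (rule runs_nonblank[OF suf])
    fix c r' assume r: "r = c # r'"
    have s1: "suffix (c # r') e" using suf r by simp
    have s2: "suffix r' e" using s1 by (rule suffix_ConsD)
    have "map_option (\<lambda>(b, r'). ?ts r' (scan (vs @ [b]) [b])) (gate_step vs (False # True # r')) =
       map_option (\<lambda>(i, r1). ?ts r1 (scan (vs @ [\<not> vs ! i]) [\<not> vs ! i])) (fetched vs r')"
      by (auto simp: gate_step_def fetched_def split: option.splits if_splits bind_split)
    moreover have "runs push_not (?ts r' (scan vs u)) ?T
       (map_option (\<lambda>(i, r1). ?ts r1 (scan (vs @ [\<not> vs ! i]) [\<not> vs ! i])) (fetched vs r'))"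
      by (rule runs_mono[OF runs_push_not[OF s2 assms(2)]]) (simp add: r)
    ultimately have n: "c \<Longrightarrow> runs push_not (?ts r' (scan vs u)) ?T
      (map_option (\<lambda>(b, r'). ?ts r' (scan (vs @ [b]) [b])) (gate_step vs (False # r)))"
      by (simp only: r)
    from runs_mono[OF const[OF s2], of ?T]
    show "runs (Cond 3 one (right 3 ;; push_not)
       (right 3 ;; Cond 3 nonblank Skip Exit ;;
        Cond 3 one (right 3 ;; push True) (right 3 ;; push False)))
      (?ts (c # r') (scan vs u)) (?T + 3)
      (map_option (\<lambda>(b, r'). ?ts r' (scan (vs @ [b]) [b])) (gate_step vs (False # r)))"
      by (intro runs_branch[OF s1] n) (simp_all add: r)
  qed (simp add: gate_step_def)
  have "runs run_gate (?ts (a # r) (scan vs u)) (?T + 3 + 2 + 3)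
    (map_option (\<lambda>(b, r'). ?ts r' (scan (vs @ [b]) [b])) (gate_step vs (a # r)))"
    unfolding run_gate_def by (rule runs_branch[OF assms(1)]) (use pos neg in \<open>simp_all\<close>)
  then show ?thesis by (rule runs_mono) simp
qed

lemma parse_gate_Some: "parse_gate r = Some (g, r') \<longleftrightarrow> r = enc_gate g @ r'"
proof
  assume "parse_gate r = Some (g, r')"
  then show "r = enc_gate g @ r'"
    by (cases r rule: parse_gate.cases)
      (auto simp: bind_eq_Some_conv unary_Some split: if_splits)
next
  have "unary (enc_nat i @ u) = Some (i, u)" for i u by (simp add: unary_Some)
  then show "r = enc_gate g @ r' \<Longrightarrow> parse_gate r = Some (g, r')"
    by (cases g) auto
qed

lemma gate_step_Some:
  "gate_step vs r = Some (b, r') \<longleftrightarrow>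
   (\<exists>g. r = enc_gate g @ r' \<and> operands g \<subseteq> {..<length vs} \<and> b = gate_value vs g)"
  by (auto simp: gate_step_def bind_eq_Some_conv parse_gate_Some split: if_splits)

lemma enc_gate_nonempty: "enc_gate g \<noteq> []"
  by (cases g) auto

text \<open>Gates are not separated in the encoding; each is parsed off the front of the rest. Since
  \<open>vs\<close> contains all wires numbered so far, comparing operands with its length is the
  check of the topological order.\<close>

function run_gates :: "bool list \<Rightarrow> bool list \<Rightarrow> bool list option" where
  "run_gates vs r = (if r = [] then Some vs
     else case gate_step vs r of None \<Rightarrow> None | Some (b, r') \<Rightarrow> run_gates (vs @ [b]) r')"
  by pat_completeness auto
termination
  by (relation "measure (\<lambda>(vs, r). length r)") (auto simp: gate_step_Some enc_gate_nonempty)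

declare run_gates.simps [simp del]

abbreviation gate_values :: "bool list \<Rightarrow> gate list \<Rightarrow> bool list" where
  "gate_values \<equiv> foldl (\<lambda>vs g. vs @ [gate_value vs g])"

lemma run_gates_Some:
  "run_gates vs r = Some vs' \<longleftrightarrow>
   (\<exists>gs. r = concat (map enc_gate gs) \<and> vs' = gate_values vs gs \<and>
      (\<forall>k < length gs. \<forall>i \<in> operands (gs ! k). i < length vs + k))"
proof
  assume "run_gates vs r = Some vs'"
  then show "\<exists>gs. r = concat (map enc_gate gs) \<and> vs' = gate_values vs gs \<and>
      (\<forall>k < length gs. \<forall>i \<in> operands (gs ! k). i < length vs + k)"
  proof (induction vs r rule: run_gates.induct)
    case (1 vs r)
    show ?case
    proof (cases "r = []")
      case True
      then show ?thesis using 1 by (intro exI[of _ "[]"]) (simp add: run_gates.simps)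
    next
      case False
      then obtain b r' where s: "gate_step vs r = Some (b, r')"
        and rec: "run_gates (vs @ [b]) r' = Some vs'"
        using 1(2) by (auto simp: run_gates.simps[of vs r] split: option.splits)
      obtain g where g: "r = enc_gate g @ r'" "operands g \<subseteq> {..<length vs}" "b = gate_value vs g"
        using s by (auto simp: gate_step_Some)
      from 1(1)[OF False s refl rec] obtain gs where gs: "r' = concat (map enc_gate gs)"
        "vs' = gate_values (vs @ [b]) gs"
        "\<forall>k < length gs. \<forall>i \<in> operands (gs ! k). i < length (vs @ [b]) + k" by blast
      have "\<forall>k < length (g # gs). \<forall>i \<in> operands ((g # gs) ! k). i < length vs + k"
      proof (intro allI impI ballI)
        fix k i assume "k < length (g # gs)" "i \<in> operands ((g # gs) ! k)"
        then show "i < length vs + k" using g(2) gs(3) by (cases k) auto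
      qed
      then show ?thesis using g gs by (intro exI[of _ "g # gs"]) simp
    qed
  qed
next
  assume "\<exists>gs. r = concat (map enc_gate gs) \<and> vs' = gate_values vs gs \<and>
      (\<forall>k < length gs. \<forall>i \<in> operands (gs ! k). i < length vs + k)"
  then obtain gs where "r = concat (map enc_gate gs)" "vs' = gate_values vs gs"
    "\<forall>k < length gs. \<forall>i \<in> operands (gs ! k). i < length vs + k" by blast
  then show "run_gates vs r = Some vs'"
  proof (induction gs arbitrary: vs r)
    case Nil
    then show ?case by (simp add: run_gates.simps)
  next
    case (Cons g gs)
    let ?b = "gate_value vs g" and ?r = "concat (map enc_gate gs)"
    have "operands g \<subseteq> {..<length vs}" using Cons.prems(3) by force
    then have "gate_step vs r = Some (?b, ?r)"
      using Cons.prems(1) by (auto simp: gate_step_Some)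
    moreover have "run_gates (vs @ [?b]) ?r = Some vs'"
      using Cons.prems by (intro Cons.IH) force+
    moreover have "r \<noteq> []" using Cons.prems(1) by (simp add: enc_gate_nonempty)
    ultimately show ?case by (simp add: run_gates.simps[of vs r])
  qed
qed

lemma length_gate_values: "length (gate_values vs gs) = length vs + length gs"
  by (induction gs arbitrary: vs) auto

text \<open>Every gate takes at least one bit, so there are no more gates than bits.\<close>

lemma run_gates_length:
  assumes "run_gates vs r = Some vs'"
  shows "length vs' \<le> length vs + length r"
proof -
  obtain gs where "r = concat (map enc_gate gs)" "vs' = gate_values vs gs"
    using assms by (auto simp: run_gates_Some)
  moreover have "length gs \<le> length (concat (map enc_gate gs))" for gs
  proof (induction gs)
    case (Cons g gs)
    then show ?case using enc_gate_nonempty[of g] by (cases "enc_gate g") auto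
  qed simp
  ultimately show ?thesis by (simp add: length_gate_values)
qed

text \<open>The position on tape 4 is left existential since it depends on whether any gate was
  processed; the next access rewinds that tape. For the bound, a gate adds one wire and removes at
  least one bit, so \<open>length vs + length r\<close> never grows, and each of the at most
  \<open>length r\<close> rounds costs linear time.\<close>

lemma runs_gates:
  assumes "suffix r e" "suffix u vs"
  shows "\<exists>u'. (\<forall>vs'. run_gates vs r = Some vs' \<longrightarrow> suffix (u' vs') vs') \<and>
    runs (While 3 nonblank run_gate) (t0 # x # y # scan e r # scan vs u # f # rest)
      (length r * (12 * (length vs + length r) + 54) + 1)
      (map_option (\<lambda>vs'. t0 # x # y # scan e [] # scan vs' (u' vs') # f # rest) (run_gates vs r))"
  using assms
proof (induction vs r arbitrary: u rule: run_gates.induct)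
  case (1 vs r)
  let ?ts = "\<lambda>r w. t0 # x # y # scan e r # w # f # rest"
  show ?case
  proof (cases r)
    case Nil
    have "runs (While 3 nonblank run_gate) (?ts [] (scan vs u)) 1 (Some (?ts [] (scan vs u)))"
      by (rule runs_While_stop) simp_all
    then show ?thesis using Nil 1(3) by (intro exI[of _ "\<lambda>_. u"]) (simp add: run_gates.simps)
  next
    case (Cons a q)
    have nb: "nonblank ((?ts r (scan vs u) ! 3) 0)" using 1(2) Cons by simp
    have g: "runs run_gate (?ts r (scan vs u)) (9 * length vs + 12 * length q + 52)
       (map_option (\<lambda>(b, r'). ?ts r' (scan (vs @ [b]) [b])) (gate_step vs r))"
      using runs_run_gate[of a q e u vs] 1(2,3) Cons by simp
    show ?thesis
    proof (cases "gate_step vs r")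
      case None
      then have "runs (While 3 nonblank run_gate) (?ts r (scan vs u)) (9 * length vs + 12 * length q + 52 + 2) None"
        using g by (intro runs_While_Exit[where P = nonblank, OF _ nb]) simp_all
      moreover have "run_gates vs r = None" using None Cons by (subst run_gates.simps) simp
      ultimately show ?thesis using Cons by (auto intro: runs_mono)
    next
      case (Some p)
      obtain b r' where p: "p = (b, r')" by fastforce
      then obtain h where h: "r = enc_gate h @ r'" using Some by (auto simp: gate_step_Some)
      then have len: "length r' \<le> length q" "suffix r' r" using enc_gate_nonempty[of h] Cons
        by (cases "enc_gate h"; simp add: suffix_def)+
      have suf: "suffix r' e" using 1(2) len(2) suffix_order.trans by blast
      from g Some p have g': "runs run_gate (?ts r (scan vs u)) (9 * length vs + 12 * length q + 52)
          (Some (?ts r' (scan (vs @ [b]) [b])))" by simp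
      have rg: "run_gates vs r = run_gates (vs @ [b]) r'"
        using Some p Cons by (subst run_gates.simps) simp
      have "r \<noteq> []" using Cons by simp
      from 1(1)[OF this Some p[symmetric] suf, of "[b]"] obtain u' where
        u': "\<forall>vs'. run_gates (vs @ [b]) r' = Some vs' \<longrightarrow> suffix (u' vs') vs'"
        and R: "runs (While 3 nonblank run_gate) (?ts r' (scan (vs @ [b]) [b]))
          (length r' * (12 * (length (vs @ [b]) + length r') + 54) + 1)
          (map_option (\<lambda>vs'. ?ts [] (scan vs' (u' vs'))) (run_gates (vs @ [b]) r'))"
        by (auto simp: suffix_def)
      have "length r' * (12 * (length (vs @ [b]) + length r') + 54) \<le>
          length q * (12 * (length vs + length r) + 54)"
        using len Cons by (intro mult_mono) auto
      then have "(9 * length vs + 12 * length q + 52) +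
          (length r' * (12 * (length (vs @ [b]) + length r') + 54) + 1) + 2
          \<le> length r * (12 * (length vs + length r) + 54) + 1"
        using Cons by simp
      from runs_mono[OF runs_While_step[where P = nonblank, OF _ nb g' R] this] u' rg
      show ?thesis by (intro exI[of _ u']) simp
    qed
  qed
qed

text \<open>It differs from \<open>fetch\<close> in the last test, which now demands the blank: the
  number of inputs must equal the length of the word on tape 4. This is where an \<open>x\<close> of
  the wrong length is rejected.\<close>

definition "check_inputs = rewind 4 ;; walk ;; accept_bit ;; Cond 4 nonblank Exit Skip"

lemma runs_check_inputs:
  assumes "suffix r e" "suffix u vs"
  shows "runs check_inputs (t0 # x # y # scan e r # scan vs u # f # rest) (3 * length vs + 6 * length r + 16)
    (case unary r of None \<Rightarrow> None | Some (i, r') \<Rightarrow>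
      if i = length vs then Some (t0 # x # y # scan e r' # scan vs [] # f # rest) else None)"
proof -
  let ?ts = "\<lambda>r u. t0 # x # y # scan e r # scan vs u # f # rest"
  let ?k = "length (takeWhile (\<lambda>b. b) r)" and ?d = "dropWhile (\<lambda>b. b) r"
  have rew: "runs (rewind 4) (?ts r u) (3 * length vs + 6) (Some (?ts r vs))"
    using runs_rewind[of 4 "?ts r u" vs u] suffix_length_le[OF assms(2)] by simp
  have wk: "runs walk (?ts r vs) (6 * length r + 4)
      (if ?k \<le> length vs then Some (?ts ?d (drop ?k vs)) else None)"
    using runs_walk[of r e vs vs] assms(1) by simp
  have suf: "suffix ?d e" using assms(1) suffix_dropWhile suffix_order.trans by blast
  have "runs (walk ;; accept_bit ;; Cond 4 nonblank Exit Skip) (?ts r vs) (6 * length r + 4 + (2 + 1 + 1) + 1)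
     (case unary r of None \<Rightarrow> None | Some (i, r') \<Rightarrow>
      if i = length vs then Some (?ts r' []) else None)"
  proof (cases "?k \<le> length vs")
    case False
    then have "(case unary r of None \<Rightarrow> None | Some (i, r') \<Rightarrow>
      if i = length vs then Some (?ts r' []) else None) = None"
      by (auto simp: unary_def split: list.splits)
    moreover have "runs (walk ;; accept_bit ;; Cond 4 nonblank Exit Skip) (?ts r vs) (6 * length r + 4 + 1) None"
      using wk False by (intro runs_Seq_Exit) simp
    ultimately show ?thesis by (auto intro: runs_mono)
  next
    case True
    then have wk': "runs walk (?ts r vs) (6 * length r + 4) (Some (?ts ?d (drop ?k vs)))"
      using wk by simp
    have acc: "runs accept_bit (?ts ?d (drop ?k vs)) 2
        (case ?d of [] \<Rightarrow> None | a # r' \<Rightarrow> Some (?ts r' (drop ?k vs)))"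
      by (rule runs_accept_bit[OF suf])
    show ?thesis
    proof (cases ?d)
      case Nil
      from acc have "runs accept_bit (?ts ?d (drop ?k vs)) 2 None" unfolding Nil by simp
      then have "runs (accept_bit ;; Cond 4 nonblank Exit Skip) (?ts ?d (drop ?k vs)) (2 + 1) None"
        by (rule runs_Seq_Exit)
      note r = runs_Seq[OF wk' this]
      have "unary r = None" unfolding unary_def Nil by simp
      then show ?thesis using runs_mono[OF r] by simp
    next
      case (Cons a r')
      have fin: "runs (Cond 4 nonblank Exit Skip) (?ts r' (drop ?k vs)) (0 + 1)
          (if ?k = length vs then Some (?ts r' []) else None)"
        using True by (intro runs_Cond) (auto intro: runs_Skip runs_Exit)
      from acc Cons have "runs accept_bit (?ts ?d (drop ?k vs)) 2 (Some (?ts r' (drop ?k vs)))" by simp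
      note r = runs_Seq[OF wk' runs_Seq[OF this fin]]
      have "unary r = Some (?k, r')" unfolding unary_def Cons by simp
      then show ?thesis using runs_mono[OF r] by (cases "?k = length vs") simp_all
    qed
  qed
  from runs_Seq[OF rew this] show ?thesis unfolding check_inputs_def by (rule runs_mono) simp
qed

text \<open>The wire values are returned together with the output wire, rather than just the output
  bit, since they describe what is left on tape 4.\<close>

definition eval_word :: "bool list \<Rightarrow> bool list \<Rightarrow> (bool list \<times> nat) option" where
  "eval_word e z = Option.bind (unary e) (\<lambda>(i, r). if i \<noteq> length z then None
     else Option.bind (unary r) (\<lambda>(j, r'). Option.bind (run_gates z r') (\<lambda>vs.
       if j < length vs then Some (vs, j) else None)))"

lemma eval_word_Some:
  "eval_word e z = Some (vs, j) \<longleftrightarrow> (\<exists>C. e = enc_circuit C \<and> valid_circuit C \<and>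
     num_inputs C = length z \<and> vs = wire_values C z \<and> j = out_wire C)"
proof
  assume "eval_word e z = Some (vs, j)"
  then obtain r r' where "unary e = Some (length z, r)" "unary r = Some (j, r')"
    "run_gates z r' = Some vs" "j < length vs"
    by (auto simp: eval_word_def bind_eq_Some_conv split: if_splits)
  moreover from this(3) obtain gs where "r' = concat (map enc_gate gs)" "vs = gate_values z gs"
      "\<forall>k < length gs. \<forall>i \<in> operands (gs ! k). i < length z + k"
    by (auto simp: run_gates_Some)
  ultimately show "\<exists>C. e = enc_circuit C \<and> valid_circuit C \<and>
     num_inputs C = length z \<and> vs = wire_values C z \<and> j = out_wire C"
    by (intro exI[of _ "\<lparr>num_inputs = length z, out_wire = j, gates = gs\<rparr>"])
      (simp add: enc_circuit_def valid_circuit_def wire_values_def unary_Some length_gate_values)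
next
  assume "\<exists>C. e = enc_circuit C \<and> valid_circuit C \<and>
     num_inputs C = length z \<and> vs = wire_values C z \<and> j = out_wire C"
  then obtain C where C: "e = enc_circuit C" "valid_circuit C" "num_inputs C = length z"
    "vs = wire_values C z" "j = out_wire C" by blast
  let ?r = "concat (map enc_gate (gates C))"
  have "unary e = Some (length z, enc_nat j @ ?r)" "unary (enc_nat j @ ?r) = Some (j, ?r)"
    using C by (simp_all add: unary_Some enc_circuit_def)
  moreover have "run_gates z ?r = Some vs"
    using C by (auto simp: run_gates_Some wire_values_def valid_circuit_def)
  moreover have "j < length vs"
    using C by (simp add: valid_circuit_def wire_values_def length_gate_values)
  ultimately show "eval_word e z = Some (vs, j)" by (simp add: eval_word_def)
qed

text \<open>In the encoding the number of the output wire stands before the gates, so it is skipped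
  at first and read in a second pass, when all wire values are known. The final rewind prepares tape
  3 for the next block.\<close>

definition "evaluate = check_inputs ;; skip_unary ;; While 3 nonblank run_gate ;;
  rewind 3 ;; skip_unary ;; fetch ;; rewind 3"

lemma runs_evaluate:
  assumes "suffix u vs"
  shows "runs evaluate (t0 # x # y # scan e e # scan vs u # f # rest)
    (130 * (length e + length vs + 1) ^ 2)
    (map_option (\<lambda>(vs', j). t0 # x # y # scan e e # scan vs' (drop j vs') # f # rest) (eval_word e vs))"
proof -
  let ?ts = "\<lambda>r w. t0 # x # y # scan e r # w # f # rest"
  let ?n = "length e" and ?m = "length vs"
  \<comment> \<open>The time of the gate loop plus linear terms for the remaining phases, where
    \<open>length vs + length e\<close> bounds the number of wires. The square with factor 130 is a
    generous majorant.\<close>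
  let ?B = "?n * (12 * (?m + ?n) + 54) + 36 * ?n + 6 * ?m + 66"
  have sq: "?B \<le> 130 * (?n + ?m + 1) ^ 2"
    by (simp add: power2_eq_square algebra_simps)
  have ci: "runs check_inputs (?ts e (scan vs u)) (3 * ?m + 6 * ?n + 16)
    (case unary e of None \<Rightarrow> None | Some (i, r') \<Rightarrow>
      if i = length vs then Some (?ts r' (scan vs [])) else None)"
    by (rule runs_check_inputs) (simp_all add: assms)
  have "runs evaluate (?ts e (scan vs u)) ?B
    (map_option (\<lambda>(vs', j). ?ts e (scan vs' (drop j vs'))) (eval_word e vs))"
  proof (cases "\<exists>r. unary e = Some (length vs, r)")
    case False
    then have "eval_word e vs = None" "(case unary e of None \<Rightarrow> None | Some (i, r') \<Rightarrow>
      if i = length vs then Some (?ts r' (scan vs [])) else None) = None"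
      by (cases "unary e"; auto simp: eval_word_def)+
    with runs_mono[OF runs_Seq_Exit[of check_inputs]] ci show ?thesis
      by (simp add: evaluate_def)
  next
    case True
    then obtain r where r: "unary e = Some (length vs, r)" by blast
    have sr: "suffix r e" using unary_suffix[OF r] .
    have lr: "length r \<le> ?n" using unary_length[OF r] by simp
    have ci': "runs check_inputs (?ts e (scan vs u)) (3 * ?m + 6 * ?n + 16) (Some (?ts r (scan vs [])))"
      using ci r by simp
    have sk: "runs skip_unary (?ts r (scan vs [])) (3 * length r + 4)
        (map_option (\<lambda>(i, r'). ?ts r' (scan vs [])) (unary r))"
      by (rule runs_skip_unary[OF sr])
    show ?thesis
    proof (cases "unary r")
      case None
      then have "runs skip_unary (?ts r (scan vs [])) (3 * length r + 4) None" using sk by simp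
      from runs_mono[OF runs_Seq[OF ci' runs_Seq_Exit[OF this]]] None r lr show ?thesis
        by (simp add: evaluate_def eval_word_def)
    next
      case (Some p)
      obtain j q where p: "p = (j, q)" by fastforce
      have sq: "suffix q e" using unary_suffix Some p sr suffix_order.trans by blast
      have lq: "length q \<le> ?n" using unary_length[of r j q] Some p lr by simp
      have sk': "runs skip_unary (?ts r (scan vs [])) (3 * length r + 4) (Some (?ts q (scan vs [])))"
        using sk Some p by simp
      obtain u' where u': "\<forall>vs'. run_gates vs q = Some vs' \<longrightarrow> suffix (u' vs') vs'"
        and gl: "runs (While 3 nonblank run_gate) (?ts q (scan vs []))
          (length q * (12 * (?m + length q) + 54) + 1)
          (map_option (\<lambda>vs'. ?ts [] (scan vs' (u' vs'))) (run_gates vs q))"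
        using runs_gates[OF sq suffix_bot.bot_least[of vs], of t0 x y f rest] by blast
      have mono: "length q * (12 * (?m + length q) + 54) \<le> ?n * (12 * (?m + ?n) + 54)"
        using lq by (intro mult_mono) auto
      show ?thesis
      proof (cases "run_gates vs q")
        case None
        then have "runs (While 3 nonblank run_gate) (?ts q (scan vs []))
          (length q * (12 * (?m + length q) + 54) + 1) None" using gl by simp
        from runs_mono[OF runs_Seq[OF ci' runs_Seq[OF sk' runs_Seq_Exit[OF this]]]]
          None r Some p lr mono show ?thesis
          by (simp add: evaluate_def eval_word_def)
      next
        case (Some ws)
        have gl': "runs (While 3 nonblank run_gate) (?ts q (scan vs []))
          (length q * (12 * (?m + length q) + 54) + 1) (Some (?ts [] (scan ws (u' ws))))"
          using gl Some by simp
        have suw: "suffix (u' ws) ws" using u' Some by blast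
        have lw: "length ws \<le> ?m + ?n" using run_gates_length[OF Some] lq by simp
        have re: "runs (rewind 3) (?ts q' (scan ws w)) (3 * ?n + 6) (Some (?ts e (scan ws w)))"
          if "suffix q' e" for q' w
          using runs_rewind[of 3 "?ts q' (scan ws w)" e q'] suffix_length_le[OF that] by simp
        have sk2: "runs skip_unary (?ts e (scan ws (u' ws))) (3 * ?n + 4) (Some (?ts r (scan ws (u' ws))))"
          using runs_skip_unary[of e e] r by simp
        have fe: "runs fetch (?ts r (scan ws (u' ws))) (3 * length ws + 6 * length r + 16)
          (map_option (\<lambda>(i, r'). ?ts r' (scan ws (drop i ws))) (fetched ws r))"
          by (rule runs_fetch[OF sr suw])
        show ?thesis
        proof (cases "j < length ws")
          case False
          then have "runs fetch (?ts r (scan ws (u' ws))) (3 * length ws + 6 * length r + 16) None"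
            using fe \<open>unary r = Some p\<close> p by (simp add: fetched_def)
          from runs_mono[OF runs_Seq[OF ci' runs_Seq[OF sk' runs_Seq[OF gl' runs_Seq[OF re
              runs_Seq[OF sk2 runs_Seq_Exit[OF this]]]]]]]
            False r Some \<open>unary r = Some p\<close> p lr lw mono show ?thesis
            by (simp add: evaluate_def eval_word_def)
        next
          case True
          then have "runs fetch (?ts r (scan ws (u' ws))) (3 * length ws + 6 * length r + 16)
              (Some (?ts q (scan ws (drop j ws))))"
            using fe \<open>unary r = Some p\<close> p by (simp add: fetched_def)
          from runs_mono[OF runs_Seq[OF ci' runs_Seq[OF sk' runs_Seq[OF gl' runs_Seq[OF re
              runs_Seq[OF sk2 runs_Seq[OF this re[OF sq]]]]]]]]
            True r Some \<open>unary r = Some p\<close> p lr lw mono show ?thesis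
            by (simp add: evaluate_def eval_word_def)
        qed
      qed
    qed
  qed
  from runs_mono[OF this sq] show ?thesis .
qed

section \<open>The verifier\<close>

text \<open>The word \<open>y\<close> is a sequence of blocks, each a bit \<open>b\<close> followed by a string \<open>z\<close> of the length of \<open>x\<close>,
  where missing bits at the end of \<open>y\<close> count as \<open>False\<close>. The bit selects the order of the
  arguments: \<open>True\<close> asks for \<open>C(xz) = 1\<close>, \<open>False\<close> for \<open>C(zx) = 0\<close>. The leading bit also guarantees
  that the machine makes progress on \<open>y\<close> if \<open>x\<close> is empty.\<close>

fun block :: "nat \<Rightarrow> bool list \<Rightarrow> bool list" where
  "block 0 y = []"
| "block (Suc n) [] = False # block n []"
| "block (Suc n) (b # y) = b # block n y"

lemma length_block [simp]: "length (block n y) = n"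
  by (induction n y rule: block.induct) auto

lemma block_append: "length y = n \<Longrightarrow> block n (y @ z) = y"
  by (induction n y rule: block.induct) auto

definition "copy_bit i j = Cond i one (put_right j True) (put_right j False)"

definition "append_x = While 1 nonblank (copy_bit 1 4 ;; right 1) ;; rewind 1"

lemma runs_append_x:
  "runs append_x (t0 # scan x x # y # e # scan vs [] # f # rest) (9 * length x + 8)
     (Some (t0 # scan x x # y # e # scan (vs @ x) [] # f # rest))"
proof -
  let ?ts = "\<lambda>u vs. t0 # scan x u # y # e # scan vs [] # f # rest"
  have loop: "runs (While 1 nonblank (copy_bit 1 4 ;; right 1)) (?ts u vs) (6 * length u + 1)
      (Some (?ts [] (vs @ u)))" if "suffix u x" for u vs
    using that
  proof (induction u arbitrary: vs)
    case Nil
    have "runs (While 1 nonblank (copy_bit 1 4 ;; right 1)) (?ts [] vs) 1 (Some (?ts [] vs))"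
      by (rule runs_While_stop) simp_all
    then show ?case by simp
  next
    case (Cons a u)
    have nb: "nonblank ((?ts (a # u) vs ! 1) 0)" using Cons.prems by simp
    have 1: "runs (put_right 4 b) (?ts (a # u) vs) 1 (Some (?ts (a # u) (vs @ [b])))" for b
      using runs_Op[of 4 "?ts (a # u) vs" "Some (Bit b)" MoveRight] by simp
    have 2: "runs (copy_bit 1 4) (?ts (a # u) vs) (1 + 1) (Some (?ts (a # u) (vs @ [a])))"
      unfolding copy_bit_def by (rule runs_Cond) (use Cons.prems 1[of True] 1[of False] in auto)
    have 3: "runs (right 1) (?ts (a # u) (vs @ [a])) 1 (Some (?ts u (vs @ [a])))"
      using runs_Op[of 1 "?ts (a # u) (vs @ [a])" None MoveRight]
      by (simp del: move_head.simps scan_Cons)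
    from runs_mono[OF runs_While_step[where P = nonblank, OF _ nb runs_Seq[OF 2 3]
          Cons.IH[OF suffix_ConsD[OF Cons.prems]]]]
    show ?case by simp
  qed
  have "runs (rewind 1) (?ts [] (vs @ x)) (3 * length x + 6) (Some (?ts x (vs @ x)))"
    using runs_rewind[of 1 "?ts [] (vs @ x)" x "[]"] by simp
  from runs_mono[OF runs_Seq[OF loop this]] show ?thesis by (simp add: append_x_def)
qed

text \<open>The word \<open>x\<close> on tape 1 serves as a counter for the length of the block. On
  an exhausted \<open>y\<close> the test \<open>one\<close> fails, so \<open>False\<close> is
  supplied. Tape 5 is only ever set to \<open>True\<close> here, so it accumulates the comparison
  with \<open>x\<close>.\<close>

definition "append_y =
  While 1 nonblank
    (Cond 2 one (put_right 4 True ;; Cond 1 one Skip (put 5 True))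
              (put_right 4 False ;; Cond 1 one (put 5 True) Skip) ;;
     Cond 2 nonblank (right 2) Skip ;; right 1) ;;
  rewind 1"

lemma runs_append_y:
  assumes "suffix r y"
  shows "runs append_y (t0 # scan x x # scan y r # e # scan vs [] # scan [f] [f] # rest) (15 * length x + 8)
     (Some (t0 # scan x x # scan y (drop (length x) r) # e # scan (vs @ block (length x) r) [] #
        scan [f \<or> block (length x) r \<noteq> x] [f \<or> block (length x) r \<noteq> x] # rest))"
proof -
  let ?ts = "\<lambda>u r vs f. t0 # scan x u # scan y r # e # scan vs [] # scan [f] [f] # rest"
  let ?mark = "Cond 2 one (put_right 4 True ;; Cond 1 one Skip (put 5 True))
              (put_right 4 False ;; Cond 1 one (put 5 True) Skip)"
  let ?body = "?mark ;; Cond 2 nonblank (right 2) Skip ;; right 1"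
  have loop: "runs (While 1 nonblank ?body) (?ts u r vs f) (12 * length u + 1)
      (Some (?ts [] (drop (length u) r) (vs @ block (length u) r) (f \<or> block (length u) r \<noteq> u)))"
    if "suffix u x" "suffix r y" for u r vs f
    using that
  proof (induction u arbitrary: r vs f)
    case Nil
    have "runs (While 1 nonblank ?body) (?ts [] r vs f) 1 (Some (?ts [] r vs f))"
      by (rule runs_While_stop) simp_all
    then show ?case by simp
  next
    case (Cons a u)
    define b where "b = (case r of [] \<Rightarrow> False | b # r' \<Rightarrow> b)"
    have b: "block (Suc (length u)) r = b # block (length u) (tl r)"
      by (cases r) (simp_all add: b_def)
    have one: "one (scan y r 0) \<longleftrightarrow> b" using Cons.prems(2) by (cases r) (auto simp: b_def)
    have nb: "nonblank ((?ts (a # u) r vs f ! 1) 0)" using Cons.prems by simp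
    have 1: "runs (put_right 4 c) (?ts (a # u) r vs f) 1 (Some (?ts (a # u) r (vs @ [c]) f))" for c
      using runs_Op[of 4 "?ts (a # u) r vs f" "Some (Bit c)" MoveRight] by simp
    have 2: "runs (put 5 True) (?ts (a # u) r w f) 1 (Some (?ts (a # u) r w True))" for w
      using runs_Op[of 5 "?ts (a # u) r w f" "Some (Bit True)" Stay] by simp
    have sk: "runs Skip ts 1 (Some ts)" for ts by (rule runs_mono[OF runs_Skip]) simp
    have 3: "runs (Cond 1 one Skip (put 5 True)) (?ts (a # u) r w f) (1 + 1)
        (Some (?ts (a # u) r w (f \<or> \<not> a)))" for w
      by (rule runs_Cond) (use Cons.prems 2 sk in auto)
    have 4: "runs (Cond 1 one (put 5 True) Skip) (?ts (a # u) r w f) (1 + 1)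
        (Some (?ts (a # u) r w (f \<or> a)))" for w
      by (rule runs_Cond) (use Cons.prems 2 sk in auto)
    have 5: "runs ?mark (?ts (a # u) r vs f) (1 + (1 + 1) + 1 + 1)
        (Some (?ts (a # u) r (vs @ [b]) (f \<or> b \<noteq> a)))"
      by (rule runs_Cond) (use one runs_Seq[OF 1 3, of True] runs_Seq[OF 1 4, of False] in simp_all)
    have 6: "runs (Cond 2 nonblank (right 2) Skip) (?ts (a # u) r w g) (1 + 1) (Some (?ts (a # u) (tl r) w g))" for w g
    proof (cases r)
      case Nil
      show ?thesis by (rule runs_Cond) (use sk Nil in simp_all)
    next
      case (Cons c r')
      have "runs (right 2) (?ts (a # u) r w g) 1 (Some (?ts (a # u) r' w g))"
        using runs_Op[of 2 "?ts (a # u) r w g" None MoveRight] Cons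
        by (simp del: move_head.simps scan_Cons)
      then show ?thesis using Cons \<open>suffix r y\<close> by (intro runs_Cond) simp_all
    qed
    have 7: "runs (right 1) (?ts (a # u) r w g) 1 (Some (?ts u r w g))" for r w g
      using runs_Op[of 1 "?ts (a # u) r w g" None MoveRight]
      by (simp del: move_head.simps scan_Cons)
    have tl: "suffix (tl r) y" using Cons.prems(2) by (cases r) (auto dest: suffix_ConsD)
    have "drop (length u) (tl r) = drop (Suc (length u)) r" by (simp add: drop_Suc)
    then show ?case
      using runs_mono[OF runs_While_step[where P = nonblank, OF _ nb runs_Seq[OF 5 runs_Seq[OF 6 7]]
          Cons.IH[OF suffix_ConsD[OF Cons.prems(1)] tl, of "vs @ [b]" "f \<or> b \<noteq> a"]]]
      by (simp add: b disj_ac)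
  qed
  let ?f = "f \<or> block (length x) r \<noteq> x"
  have "runs (rewind 1) (?ts [] (drop (length x) r) (vs @ block (length x) r) ?f) (3 * length x + 6)
      (Some (?ts x (drop (length x) r) (vs @ block (length x) r) ?f))"
    using runs_rewind[of 1 "?ts [] (drop (length x) r) (vs @ block (length x) r) ?f" x "[]"] by simp
  from runs_mono[OF runs_Seq[OF loop[OF _ assms] this]] show ?thesis
    unfolding append_y_def by simp
qed

definition "clear = While 4 nonblank (right 4) ;; left 4 ;; While 4 nonblank (Op 4 (Some Blank) MoveLeft)"

lemma runs_clear:
  assumes "suffix u vs"
  shows "runs clear (t0 # x # y # e # scan vs u # f # rest) (6 * length vs + 5)
    (Some (t0 # x # y # e # scan [] [] # f # rest))"
proof -
  \<comment> \<open>The head stands on the last cell of the word. For the empty word this is one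
    cell to the left of the origin, but a blank tape looks the same from everywhere, hence
    \<open>final_cell [] = scan [] []\<close>.\<close>
  define final_cell where "final_cell vs = (\<lambda>j. word_tape vs (j + int (length vs) - 1))" for vs
  let ?ts = "\<lambda>w. t0 # x # y # e # w # f # rest"
  have final_cell: "move_head MoveLeft (scan vs []) = final_cell vs" "final_cell [] = scan [] []"
    "final_cell (vs @ [a]) 0 = Bit a" "act (Blank, MoveLeft) (final_cell (vs @ [a])) = final_cell vs" for a vs
    by (auto simp: final_cell_def scan_def word_tape_def act_def fun_eq_iff nth_append algebra_simps nat_diff_distrib')
  have loop: "runs (While 4 nonblank (Op 4 (Some Blank) MoveLeft)) (?ts (final_cell vs)) (3 * length vs + 1)
      (Some (?ts (scan [] [])))" for vs
  proof (induction vs rule: rev_induct)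
    case Nil
    have "runs (While 4 nonblank (Op 4 (Some Blank) MoveLeft)) (?ts (scan [] [])) 1 (Some (?ts (scan [] [])))"
      by (rule runs_While_stop) simp_all
    then show ?case by (simp add: final_cell)
  next
    case (snoc a vs)
    have nb: "nonblank ((?ts (final_cell (vs @ [a])) ! 4) 0)" by (simp add: final_cell)
    have "runs (Op 4 (Some Blank) MoveLeft) (?ts (final_cell (vs @ [a]))) 1 (Some (?ts (final_cell vs)))"
      using runs_Op[of 4 "?ts (final_cell (vs @ [a]))" "Some Blank" MoveLeft] by (simp add: final_cell)
    from runs_mono[OF runs_While_step[where P = nonblank, OF _ nb this snoc]] show ?case by simp
  qed
  have 1: "runs (While 4 nonblank (right 4)) (?ts (scan vs u)) (3 * length u + 1) (Some (?ts (scan vs [])))"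
    using runs_seek[of 4 "?ts (scan vs u)" u vs] assms by simp
  have 2: "runs (left 4) (?ts (scan vs [])) 1 (Some (?ts (final_cell vs)))"
    using runs_Op[of 4 "?ts (scan vs [])" None MoveLeft]
    by (simp add: final_cell del: move_head.simps scan_Nil)
  from runs_mono[OF runs_Seq[OF 1 runs_Seq[OF 2 loop]]] suffix_length_le[OF assms]
  show ?thesis by (simp add: clear_def)
qed

definition "reject_unless_equal = Cond 5 one Exit Skip"

definition "check_block = clear ;; put 5 False ;;
  Cond 2 one
    (right 2 ;; append_x ;; append_y ;; evaluate ;; Cond 4 one Skip reject_unless_equal)
    (right 2 ;; append_y ;; append_x ;; evaluate ;; Cond 4 one reject_unless_equal Skip)"

text \<open>The case \<open>z = x\<close> is exempt as in the definition of a source, but only after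
  a successful evaluation: a wrong length of \<open>x\<close> or an invalid encoding is never
  excused.\<close>

definition block_ok :: "bool list \<Rightarrow> bool list \<Rightarrow> bool \<Rightarrow> bool list \<Rightarrow> bool" where
  "block_ok e x b r = (let z = block (length x) r in
     case eval_word e (if b then x @ z else z @ x) of None \<Rightarrow> False
     | Some (vs, j) \<Rightarrow> vs ! j = b \<or> z = x)"

lemma eval_word_length:
  "eval_word e z = Some (vs, j) \<Longrightarrow> length vs \<le> length z + length e \<and> j < length vs"
  by (auto simp: eval_word_def bind_eq_Some_conv unary_Some dest!: run_gates_length split: if_splits)

text \<open>The wire values of a block stay on tape 4 until the next block erases them. The bound on
  their number is therefore kept as an invariant of the loop over the blocks; it pays for
  \<open>clear\<close>.\<close>

lemma runs_check_block:
  assumes "suffix (b # r) y" "suffix u vs" "length vs \<le> length e + 2 * length x"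
  shows "if block_ok e x b r
    then \<exists>vs' u' f'. suffix u' vs' \<and> length vs' \<le> length e + 2 * length x \<and>
      runs check_block (t0 # scan x x # scan y (b # r) # scan e e # scan vs u # scan [f] [f] # rest)
        (200 * (length e + 2 * length x + 1) ^ 2)
        (Some (t0 # scan x x # scan y (drop (length x) r) # scan e e # scan vs' u' # scan [f'] [f'] # rest))
    else runs check_block (t0 # scan x x # scan y (b # r) # scan e e # scan vs u # scan [f] [f] # rest)
        (200 * (length e + 2 * length x + 1) ^ 2) None"
proof -
  let ?ts = "\<lambda>r w f. t0 # scan x x # scan y r # scan e e # w # scan [f] [f] # rest"
  let ?n = "length x" and ?K = "length e + 2 * length x + 1"
  let ?z = "block ?n r" and ?r = "drop ?n r"
  let ?g = "?z \<noteq> x"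
  let ?in = "if b then x @ ?z else ?z @ x"
  have sr: "suffix r y" using assms(1) by (rule suffix_ConsD)
  have c1: "runs clear (?ts (b # r) (scan vs u) f) (6 * length vs + 5) (Some (?ts (b # r) (scan [] []) f))"
    by (rule runs_clear[OF assms(2)])
  have c2: "runs (put 5 False) (?ts (b # r) (scan [] []) f) 1 (Some (?ts (b # r) (scan [] []) False))"
    using runs_Op[of 5 "?ts (b # r) (scan [] []) f" "Some (Bit False)" Stay] by simp
  have c3: "runs (right 2) (?ts (b # r) (scan [] []) False) 1 (Some (?ts r (scan [] []) False))"
    using runs_Op[of 2 "?ts (b # r) (scan [] []) False" None MoveRight]
    by (simp del: move_head.simps scan_Cons)
  have ay: "runs append_y (?ts r (scan ws []) False) (15 * ?n + 8) (Some (?ts ?r (scan (ws @ ?z) []) ?g))" for ws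
    using runs_append_y[OF sr, of t0 x "scan e e" ws False rest] by simp
  have ax: "runs append_x (?ts q (scan ws []) g) (9 * ?n + 8) (Some (?ts q (scan (ws @ x) []) g))" for q ws g
    by (rule runs_append_x)
  have K: "length e + length ?in + 1 = ?K" by simp
  have ev: "runs evaluate (?ts ?r (scan ?in []) ?g) (130 * ?K ^ 2)
      (map_option (\<lambda>(vs', j). ?ts ?r (scan vs' (drop j vs')) ?g) (eval_word e ?in))"
    unfolding K[symmetric] by (rule runs_evaluate) simp
  have reject_unless_equal: "runs reject_unless_equal (?ts ?r w ?g) (0 + 1) (if ?g then None else Some (?ts ?r w ?g))" for w
    unfolding reject_unless_equal_def by (rule runs_Cond) (auto intro: runs_Exit runs_Skip)
  have skip: "runs Skip ts 1 (Some ts)" for ts by (rule runs_mono[OF runs_Skip]) simp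
  let ?res = "case eval_word e ?in of None \<Rightarrow> None
    | Some (vs', j) \<Rightarrow> if vs' ! j = b \<or> ?z = x then Some (?ts ?r (scan vs' (drop j vs')) ?g) else None"
  have fin: "runs (evaluate ;; Cond 4 one (if b then Skip else reject_unless_equal) (if b then reject_unless_equal else Skip))
      (?ts ?r (scan ?in []) ?g) (130 * ?K ^ 2 + (1 + 1) + 1) ?res"
  proof (cases "eval_word e ?in")
    case None
    then have "runs evaluate (?ts ?r (scan ?in []) ?g) (130 * ?K ^ 2) None" using ev by simp
    from runs_mono[OF runs_Seq_Exit[OF this]] None show ?thesis by simp
  next
    case (Some p)
    obtain vs' j where p: "p = (vs', j)" by fastforce
    have j: "j < length vs'" using eval_word_length Some p by blast
    from ev Some p have ev': "runs evaluate (?ts ?r (scan ?in []) ?g) (130 * ?K ^ 2)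
        (Some (?ts ?r (scan vs' (drop j vs')) ?g))" by simp
    have "runs (Cond 4 one (if b then Skip else reject_unless_equal) (if b then reject_unless_equal else Skip))
        (?ts ?r (scan vs' (drop j vs')) ?g) (1 + 1)
        (if vs' ! j = b \<or> ?z = x then Some (?ts ?r (scan vs' (drop j vs')) ?g) else None)"
      by (rule runs_Cond) (use j reject_unless_equal[of "scan vs' (drop j vs')"] skip in \<open>auto split: if_splits\<close>)
    from runs_Seq[OF ev' this] Some p show ?thesis by simp
  qed
  let ?T = "24 * ?n + 19 + (130 * ?K ^ 2 + (1 + 1) + 1)"
  have br: "runs (Cond 2 one
    (right 2 ;; append_x ;; append_y ;; evaluate ;; Cond 4 one Skip reject_unless_equal)
    (right 2 ;; append_y ;; append_x ;; evaluate ;; Cond 4 one reject_unless_equal Skip)) (?ts (b # r) (scan [] []) False)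
    (?T + 1 + 1) ?res"
  proof (rule runs_Cond)
    assume "one ((?ts (b # r) (scan [] []) False ! 2) 0)"
    then have b using assms(1) by simp
    with fin have fin': "runs (evaluate ;; Cond 4 one Skip reject_unless_equal)
      (?ts ?r (scan (([] @ x) @ ?z) []) ?g) (130 * ?K ^ 2 + (1 + 1) + 1) ?res" by simp
    from runs_mono[OF runs_Seq[OF c3 runs_Seq[OF ax runs_Seq[OF ay fin']]]]
    show "runs (right 2 ;; append_x ;; append_y ;; evaluate ;; Cond 4 one Skip reject_unless_equal)
      (?ts (b # r) (scan [] []) False) (?T + 1) ?res" by simp
  next
    assume "\<not> one ((?ts (b # r) (scan [] []) False ! 2) 0)"
    then have "\<not> b" using assms(1) by simp
    with fin have fin': "runs (evaluate ;; Cond 4 one reject_unless_equal Skip)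
      (?ts ?r (scan (([] @ ?z) @ x) []) ?g) (130 * ?K ^ 2 + (1 + 1) + 1) ?res" by simp
    from runs_mono[OF runs_Seq[OF c3 runs_Seq[OF ay runs_Seq[OF ax fin']]]]
    show "runs (right 2 ;; append_y ;; append_x ;; evaluate ;; Cond 4 one reject_unless_equal Skip)
      (?ts (b # r) (scan [] []) False) (?T + 1) ?res" by simp
  qed simp
  \<comment> \<open>Everything but the evaluation is linear in \<open>?K\<close>. As
    \<open>?K\<close> is at least 1, the linear part is absorbed into the square, whence 200 = 70 +
    130.\<close>
  have "6 * length vs + 5 + (1 + (?T + 1 + 1) + 1) + 1 \<le> 70 * ?K + 130 * ?K ^ 2"
    using assms(3) by simp
  also have "\<dots> \<le> 200 * ?K ^ 2" by (simp add: power2_eq_square)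
  finally have R: "runs check_block (?ts (b # r) (scan vs u) f) (200 * ?K ^ 2) ?res"
    unfolding check_block_def using runs_mono[OF runs_Seq[OF c1 runs_Seq[OF c2 br]]] by blast
  have bo: "block_ok e x b r \<longleftrightarrow> (case eval_word e ?in of None \<Rightarrow> False
      | Some (vs, j) \<Rightarrow> vs ! j = b \<or> ?z = x)"
    by (simp only: block_ok_def Let_def)
  obtain w where w: "eval_word e ?in = w" by blast
  show ?thesis
  proof (cases "block_ok e x b r")
    case False
    then have "?res = None" using bo unfolding w by (cases w) (auto split: if_splits)
    with False R show ?thesis by simp
  next
    case True
    then obtain vs' j where v: "w = Some (vs', j)" "vs' ! j = b \<or> ?z = x"
      using bo unfolding w by (cases w) auto
    have "length vs' \<le> length ?in + length e" using eval_word_length w v(1) by blast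
    then have l: "length vs' \<le> length e + 2 * ?n" by (simp split: if_splits)
    have "?res = Some (?ts ?r (scan vs' (drop j vs')) ?g)" unfolding w using v by simp
    with R have R': "runs check_block (?ts (b # r) (scan vs u) f) (200 * ?K ^ 2)
        (Some (?ts ?r (scan vs' (drop j vs')) ?g))" by (simp only:)
    show ?thesis unfolding if_P[OF True]
      by (intro exI[of _ vs'] exI[of _ "drop j vs'"] exI[of _ ?g] conjI suffix_drop l R')
  qed
qed

text \<open>The semantics of the loop over \<open>y\<close>. The empty \<open>y\<close> is accepted
  with every \<open>x\<close>, so a refuting \<open>y\<close> has to be nonempty.\<close>

function accepts :: "bool list \<Rightarrow> bool list \<Rightarrow> bool list \<Rightarrow> bool" where
  "accepts e x [] = True"
| "accepts e x (b # r) = (block_ok e x b r \<and> accepts e x (drop (length x) r))"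
  by pat_completeness auto
termination by (relation "measure (\<lambda>(e, x, r). length r)") auto

lemma runs_check_blocks:
  assumes "suffix r y" "suffix u vs" "length vs \<le> length e + 2 * length x"
  shows "\<exists>ts'. ts' \<noteq> [] \<and> runs (While 2 nonblank check_block)
    (t0 # scan x x # scan y r # scan e e # scan vs u # scan [f] [f] # rest)
    (length r * (200 * (length e + 2 * length x + 1) ^ 2 + 2) + 1)
    (if accepts e x r then Some ts' else None)"
  using assms
proof (induction e x r arbitrary: u vs f rule: accepts.induct)
  case (1 e x)
  let ?ts = "t0 # scan x x # scan y [] # scan e e # scan vs u # scan [f] [f] # rest"
  have "runs (While 2 nonblank check_block) ?ts 1 (Some ?ts)"
    by (rule runs_While_stop) simp_all
  then show ?case by (intro exI[of _ ?ts]) simp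
next
  case (2 e x b r)
  let ?ts = "\<lambda>r w f. t0 # scan x x # scan y r # scan e e # w # scan [f] [f] # rest"
  let ?B = "200 * (length e + 2 * length x + 1) ^ 2"
  have nb: "nonblank ((?ts (b # r) (scan vs u) f ! 2) 0)" using 2(2) by simp
  note c = runs_check_block[OF 2(2-4), of t0 f rest]
  show ?case
  proof (cases "block_ok e x b r")
    case False
    with c have "runs check_block (?ts (b # r) (scan vs u) f) ?B None" by simp
    from runs_mono[OF runs_While_Exit[where P = nonblank, OF _ nb this]] False
    show ?thesis by (intro exI[of _ "[t0]"]) simp
  next
    case True
    with c obtain vs' u' f' where v: "suffix u' vs'" "length vs' \<le> length e + 2 * length x"
      and R: "runs check_block (?ts (b # r) (scan vs u) f) ?B
        (Some (?ts (drop (length x) r) (scan vs' u') f'))" by auto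
    have suf: "suffix (drop (length x) r) y"
      using 2(2) suffix_drop suffix_ConsD suffix_order.trans by metis
    from 2(1)[OF suf v] obtain ts' where "ts' \<noteq> []" and L: "runs (While 2 nonblank check_block)
       (?ts (drop (length x) r) (scan vs' u') f')
       (length (drop (length x) r) * (?B + 2) + 1)
       (if accepts e x (drop (length x) r) then Some ts' else None)" by blast
    have "length (drop (length x) r) * (?B + 2) \<le> length r * (?B + 2)"
      by (intro mult_right_mono) simp_all
    then have "?B + (length (drop (length x) r) * (?B + 2) + 1) + 2 \<le> length (b # r) * (?B + 2) + 1"
      by simp
    from runs_mono[OF runs_While_step[where P = nonblank, OF _ nb R L] this] True \<open>ts' \<noteq> []\<close>
    show ?thesis by (intro exI[of _ ts']) simp
  qed
qed

section \<open>Assembling the verifier and writing its answer\<close>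

definition "load = While 0 nonblank (copy_bit 0 3 ;; right 0) ;; rewind 3"

text \<open>\<open>tape_reads\<close> says nothing about the cells to the left of the head or behind
  the first blank, so the output of the simulated machine is copied to the clean tape 3 before it is
  decoded.\<close>

lemma runs_load:
  assumes "tape_reads t v"
  shows "\<exists>t'. runs load (t # x # y # scan [] [] # rest) (9 * length v + 8)
    (Some (t' # x # y # scan v v # rest))"
proof -
  have loop: "\<exists>t'. runs (While 0 nonblank (copy_bit 0 3 ;; right 0)) (t # x # y # scan p [] # rest)
      (6 * length v + 1) (Some (t' # x # y # scan (p @ v) [] # rest))" for p
    using assms
  proof (induction v arbitrary: t p)
    case Nil
    then have "t 0 = Blank" by (simp add: tape_reads_def)
    then have "runs (While 0 nonblank (copy_bit 0 3 ;; right 0)) (t # x # y # scan p [] # rest)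
        1 (Some (t # x # y # scan p [] # rest))" by (intro runs_While_stop) simp_all
    then show ?case by auto
  next
    case (Cons a v)
    let ?ts = "\<lambda>t p. t # x # y # scan p [] # rest"
    have t0: "t 0 = Bit a" using Cons.prems by (force simp: tape_reads_def)
    have nb: "nonblank ((?ts t p ! 0) 0)" by (simp add: t0)
    have 1: "runs (put_right 3 b) (?ts t p) 1 (Some (?ts t (p @ [b])))" for b
      using runs_Op[of 3 "?ts t p" "Some (Bit b)" MoveRight] by simp
    have 2: "runs (copy_bit 0 3) (?ts t p) (1 + 1) (Some (?ts t (p @ [a])))"
      unfolding copy_bit_def by (rule runs_Cond) (use t0 1[of True] 1[of False] in auto)
    have 3: "runs (right 0) (?ts t (p @ [a])) 1 (Some (?ts (\<lambda>i. t (i + 1)) (p @ [a])))"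
      using runs_Op[of 0 "?ts t (p @ [a])" None MoveRight] by simp
    have "tape_reads (\<lambda>i. t (i + 1)) v"
      unfolding tape_reads_def
    proof (intro conjI allI impI)
      fix i assume "i < length v"
      then show "t (int i + 1) = Bit (v ! i)"
        using Cons.prems unfolding tape_reads_def by (auto dest!: spec[of _ "Suc i"] simp: add.commute)
    next
      show "t (int (length v) + 1) = Blank"
        using Cons.prems by (simp add: tape_reads_def add.commute)
    qed
    from Cons.IH[OF this, of "p @ [a]"] obtain t' where
      "runs (While 0 nonblank (copy_bit 0 3 ;; right 0)) (?ts (\<lambda>i. t (i + 1)) (p @ [a]))
        (6 * length v + 1) (Some (?ts t' ((p @ [a]) @ v)))" by blast
    from runs_mono[OF runs_While_step[where P = nonblank, OF _ nb runs_Seq[OF 2 3] this]]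
    show ?case by (intro exI[of _ t']) simp
  qed
  from loop[of "[]"] obtain t' where l: "runs (While 0 nonblank (copy_bit 0 3 ;; right 0))
    (t # x # y # scan [] [] # rest) (6 * length v + 1) (Some (t' # x # y # scan v [] # rest))" by auto
  have "runs (rewind 3) (t' # x # y # scan v [] # rest) (3 * length v + 6) (Some (t' # x # y # scan v v # rest))"
    using runs_rewind[of 3 "t' # x # y # scan v [] # rest" v "[]"] by simp
  from runs_mono[OF runs_Seq[OF l this]] show ?thesis
    by (intro exI[of _ t']) (simp add: load_def)
qed

text \<open>The blank behind the bit is written explicitly since tape 0 may hold leftovers of the
  simulated machine, and \<open>tape_reads\<close> asks for a blank after the word.\<close>

definition "output b = put_right 0 b ;; Op 0 (Some Blank) MoveLeft"

lemma runs_output: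
  assumes "ts \<noteq> []"
  shows "\<exists>ts'. runs (output b) ts 3 (Some ts') \<and> tape_reads (hd ts') [b]"
proof -
  obtain t rest where ts: "ts = t # rest" using assms by (cases ts) auto
  let ?t1 = "act (Bit b, MoveRight) t"
  let ?t2 = "act (Blank, MoveLeft) ?t1"
  have 1: "runs (put_right 0 b) ts 1 (Some (?t1 # rest))"
    using runs_Op[of 0 ts "Some (Bit b)" MoveRight] by (simp add: ts)
  have 2: "runs (Op 0 (Some Blank) MoveLeft) (?t1 # rest) 1 (Some (?t2 # rest))"
    using runs_Op[of 0 "?t1 # rest" "Some Blank" MoveLeft] by simp
  have "tape_reads ?t2 [b]" by (auto simp: tape_reads_def act_def)
  with runs_mono[OF runs_Seq[OF 1 2], of 3] show ?thesis
    by (intro exI[of _ "?t2 # rest"]) (simp add: output_def)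
qed

text \<open>All failures, from a word that cannot be decoded to a refuted \<open>x\<close>, are
  exits caught by the single \<open>Try\<close>. Presetting tape 5 provides the one bit that the
  specification of the loop expects there.\<close>

definition "verifier M = Try
  (Run M (start_state M) ;; load ;; put 5 False ;; While 2 nonblank check_block ;; output True)
  (output False)"

lemma wf_verifier:
  "valid_tm M \<Longrightarrow> wf_com (num_tapes M + 5) (alphabet M) (verifier M)"
  by (simp add: verifier_def load_def check_block_def output_def append_x_def append_y_def evaluate_def
      clear_def reject_unless_equal_def copy_bit_def rewind_def run_gate_def fetch_def walk_def accept_bit_def
      skip_unary_def check_inputs_def push_binary_def push_not_def push_def valid_tm_def subset_iff
      image_subset_iff) auto

lemma runs_verifier:
  assumes M: "valid_tm M" and y: "yields_within M [w] T v"
  shows "\<exists>ts. runs (verifier M)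
      (map word_tape [w, x, y] @ replicate (num_tapes M + 5 - 3) (word_tape []))
      (T + 9 * length v + length y * (200 * (length v + 2 * length x + 1) ^ 2 + 2) + 30) (Some ts)
    \<and> tape_reads (hd ts) [accepts v x y]"
proof -
  have k: "num_tapes M > 0" and A: "insert Blank (range Bit) \<subseteq> alphabet M"
    using M by (auto simp: valid_tm_def)
  let ?blanks = "replicate (num_tapes M - 1) (word_tape [])"
  let ?us = "word_tape w # ?blanks"
  let ?m = "[scan x x, scan y y, scan [] [], scan [] [], scan [] []]"
  \<comment> \<open>The three arguments followed by blanks are regrouped as the tapes of
    \<open>M\<close> on input \<open>w\<close> with five tapes inserted behind the first.\<close>
  have init: "map word_tape [w, x, y] @ replicate (num_tapes M + 5 - 3) (word_tape []) =
      hd ?us # ?m @ tl ?us"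
    using k by (cases "num_tapes M") (simp_all add: scan_full numeral_3_eq_3)
  obtain vs where run: "(step M ^^ T) (start_state M, ?us) = (halt_state M, vs)"
    and reads: "tape_reads (hd vs) v"
    using y by (auto simp: yields_within_def init_config_def split: prod.splits)
  have range: "range (word_tape u) \<subseteq> alphabet M" for u using A by (auto simp: word_tape_def)
  have "\<forall>u \<in> set ?us. range u \<subseteq> alphabet M" using range by auto
  with runs_Run[OF M _ _ _ _ run, of ?m] M k
  have R: "runs (Run M (start_state M)) (hd ?us # ?m @ tl ?us) (T + 1) (Some (hd vs # ?m @ tl vs))"
    by (simp add: valid_tm_def)
  obtain t' where L: "runs load (hd vs # ?m @ tl vs) (9 * length v + 8)
      (Some (t' # scan x x # scan y y # scan v v # scan [] [] # scan [] [] # tl vs))"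
    using runs_load[OF reads, of "scan x x" "scan y y" "scan [] [] # scan [] [] # tl vs"] by auto
  let ?ts = "t' # scan x x # scan y y # scan v v # scan [] [] # scan [False] [False] # tl vs"
  have P: "runs (put 5 False) (t' # scan x x # scan y y # scan v v # scan [] [] # scan [] [] # tl vs)
      1 (Some ?ts)"
    using runs_Op[of 5 "t' # scan x x # scan y y # scan v v # scan [] [] # scan [] [] # tl vs"
        "Some (Bit False)" Stay] by simp
  let ?B = "length y * (200 * (length v + 2 * length x + 1) ^ 2 + 2) + 1"
  obtain ts1 where "ts1 \<noteq> []" and C: "runs (While 2 nonblank check_block) ?ts ?B
      (if accepts v x y then Some ts1 else None)"
    using runs_check_blocks[of y y "[]" "[]" v x t' False "tl vs"] by auto
  show ?thesis
  proof (cases "accepts v x y")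
    case True
    obtain ts2 where O: "runs (output True) ts1 3 (Some ts2)" "tape_reads (hd ts2) [True]"
      using runs_output[OF \<open>ts1 \<noteq> []\<close>] by blast
    from C True have C': "runs (While 2 nonblank check_block) ?ts ?B (Some ts1)" by simp
    from runs_mono[OF runs_Try[OF runs_Seq[OF R runs_Seq[OF L runs_Seq[OF P runs_Seq[OF C' O(1)]]]],
          of "output False"]] O(2) True
    show ?thesis unfolding init verifier_def by (intro exI[of _ ts2]) simp
  next
    case False
    with C have C': "runs (While 2 nonblank check_block) ?ts ?B None" by simp
    obtain us where "us \<noteq> []" and E: "\<And>d T2 r. runs d us T2 r \<Longrightarrow>
        runs (Try (Run M (start_state M) ;; load ;; put 5 False ;; While 2 nonblank check_block ;; output True) d)
        (hd ?us # ?m @ tl ?us) (T + 1 + (9 * length v + 8 + (1 + (?B + 1) + 1) + 1) + 1 + T2 + 1) r"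
      using runs_Try_Exit[OF runs_Seq[OF R runs_Seq[OF L runs_Seq[OF P runs_Seq_Exit[OF C', of "output True"]]]]]
      by (metis list.distinct(1))
    obtain ts2 where O: "runs (output False) us 3 (Some ts2)" "tape_reads (hd ts2) [False]"
      using runs_output[OF \<open>us \<noteq> []\<close>] by blast
    from runs_mono[OF E[OF O(1)]] O(2) False
    show ?thesis unfolding init verifier_def by (intro exI[of _ ts2]) simp
  qed
qed

section \<open>Polynomial running time\<close>

text \<open>Tapes are described relative to the head, so a move to the left shifts the content one
  cell to the right; this is the only way in which the bound grows. The slack of one cell between
  the two inequalities covers the symbol written in the scanned cell when
  \<open>n = 0\<close>.\<close>

lemma step_support:
  assumes "(step M ^^ T) (q, ts) = (q', us)" "\<forall>t \<in> set ts. \<forall>i \<ge> int n. t i = Blank" "u \<in> set us"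
  shows "\<forall>i > int (n + T). u i = Blank"
  using assms(1,3)
proof (induction T arbitrary: q' us u)
  case 0
  then show ?case using assms(2) by auto
next
  case (Suc T)
  obtain p vs where vs: "(step M ^^ T) (q, ts) = (p, vs)" by fastforce
  show ?case
  proof (cases "p = halt_state M")
    case True
    then have "us = vs" using Suc.prems(1) vs by (simp add: step_def)
    then show ?thesis using Suc.IH[OF vs] Suc.prems(2) by auto
  next
    case False
    then obtain as where "us = map2 act as vs"
      using Suc.prems(1) vs by (auto simp: step_def split: prod.splits)
    then obtain a v where u: "u = act a v" "v \<in> set vs"
      using Suc.prems(2) by (auto dest: set_zip_rightD)
    have v: "\<forall>i > int (n + T). v i = Blank" using Suc.IH[OF vs u(2)] .
    show ?thesis
      unfolding u(1) by (cases "snd a") (use v in \<open>auto simp: act_def\<close>)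
  qed
qed

text \<open>The last bit of \<open>v\<close> lies \<open>length v - 1\<close> cells to the right of
  the head, hence within the region that can be nonblank after \<open>T\<close> steps.\<close>

lemma yields_within_length:
  assumes M: "valid_tm M" and "yields_within M [w] T v"
  shows "length v \<le> length w + T + 1"
proof (cases "v = []")
  case False
  obtain q us where us: "(step M ^^ T) (init_config M [w]) = (q, us)" by fastforce
  with assms have r: "tape_reads (hd us) v" and q: "q = halt_state M"
    by (simp_all add: yields_within_def)
  have "\<forall>t \<in> set (snd (init_config M [w])). \<forall>i \<ge> int (length w). t i = Blank"
    by (auto simp: init_config_def word_tape_def)
  then have s: "\<forall>i > int (length w + T). hd us i = Blank" if "us \<noteq> []"
    using step_support[of T M "fst (init_config M [w])" "snd (init_config M [w])" q us "length w" "hd us"]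
      us that by simp
  have k: "num_tapes M > 0" and A: "insert Blank (range Bit) \<subseteq> alphabet M"
    using M by (auto simp: valid_tm_def)
  have "range (word_tape u) \<subseteq> alphabet M" for u using A by (auto simp: word_tape_def)
  \<comment> \<open>\<open>runs_Run\<close> is applied with five blank dummy tapes, only for its
    conclusion that the number of tapes is preserved.\<close>
  then have "length us = num_tapes M"
    using runs_Run[OF M, of "start_state M" "replicate 5 (word_tape [])" "snd (init_config M [w])" T us]
      us q M k by (auto simp: init_config_def valid_tm_def)
  then have "us \<noteq> []" using k by auto
  then have s: "\<forall>i > int (length w + T). hd us i = Blank" using s by simp
  have "hd us (int (length v - 1)) = Bit (v ! (length v - 1))"
    using r False by (simp add: tape_reads_def)
  then have "\<not> int (length v - 1) > int (length w + T)" using s by auto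
  then show ?thesis by simp
qed simp

lemma poly_nat_mono: "a \<le> b \<Longrightarrow> poly p a \<le> poly p (b :: nat)"
  unfolding poly_altdef by (intro sum_mono mult_left_mono power_mono) auto

lemma polytime_pred3_accepts:
  assumes "polytime_fun f"
  shows "polytime_pred3 (\<lambda>w. accepts (f w))"
proof -
  obtain M p where M: "valid_tm M"
    and Y: "\<And>ws. length ws = 1 \<Longrightarrow> yields_within M ws (poly p (sum_list (map length ws))) (f (ws ! 0))"
    using assms by (auto simp: polytime_fun_def polytime_def)
  have Yw: "yields_within M [w] (poly p (length w)) (f w)" for w using Y[of "[w]"] by simp
  from M have A: "finite (alphabet M)" "insert Blank (range Bit) \<subseteq> alphabet M"
    by (auto simp: valid_tm_def)
  have "Skip \<in> residuals (verifier M)" by (simp add: verifier_def)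
  from compile[OF wf_verifier[OF M] _ A this] obtain N where N: "valid_tm N" "num_tapes N = num_tapes M + 5"
    "\<And>ws T ts v. length ws \<le> num_tapes M + 5 \<Longrightarrow> runs (verifier M)
        (map word_tape ws @ replicate (num_tapes M + 5 - length ws) (word_tape [])) T (Some ts) \<Longrightarrow>
       tape_reads (hd ts) v \<Longrightarrow> yields_within N ws T v"
    by auto
  \<comment> \<open>\<open>k\<close> bounds \<open>length (f w) + 2 * length x + 1\<close>: the
    output has length at most \<open>length w + poly p (length w) + 1\<close>, and three times the
    total input length covers \<open>w\<close> and twice \<open>x\<close>. \<open>P\<close> is the
    bound of \<open>runs_verifier\<close> with \<open>k\<close> in place of that sum.\<close>
  define k where "k = p + [:2, 3:]"
  define P where "P = p + [:30:] + [:9:] * k + [:0, 1:] * ([:200:] * k ^ 2 + [:2:])"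
  have "yields_within N ws (poly P (sum_list (map length ws))) [accepts (f (ws ! 0)) (ws ! 1) (ws ! 2)]"
    if len: "length ws = 3" for ws
  proof -
    obtain w x y where ws: "ws = [w, x, y]"
      using len by (auto simp: numeral_3_eq_3 length_Suc_conv)
    let ?n = "sum_list (map length ws)"
    let ?T = "poly p (length w) + 9 * length (f w) +
      length y * (200 * (length (f w) + 2 * length x + 1) ^ 2 + 2) + 30"
    obtain ts where ts: "runs (verifier M)
      (map word_tape ws @ replicate (num_tapes M + 5 - length ws) (word_tape [])) ?T (Some ts)"
      "tape_reads (hd ts) [accepts (f w) x y]"
      using runs_verifier[OF M Yw, of w x y] by (auto simp: ws)
    have pn: "poly p (length w) \<le> poly p ?n" by (rule poly_nat_mono) (simp add: ws)
    have "length (f w) \<le> length w + poly p (length w) + 1" by (rule yields_within_length[OF M Yw])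
    then have K: "length (f w) + 2 * length x + 1 \<le> poly k ?n" using pn by (simp add: ws k_def)
    have "length y * (200 * (length (f w) + 2 * length x + 1) ^ 2 + 2) \<le>
        ?n * (200 * poly k ?n ^ 2 + 2)"
      by (intro mult_mono add_mono power_mono K) (simp_all add: ws)
    then have "?T \<le> poly P ?n" using pn K by (simp add: P_def)
    from N(3)[OF _ runs_mono[OF ts(1) this] ts(2)] show ?thesis by (simp add: ws)
  qed
  then show ?thesis using N(1,2) unfolding polytime_pred3_def polytime_def
    by (intro exI[of _ N] exI[of _ P]) simp
qed

text \<open>Injectivity of the encoding identifies the circuit found by \<open>eval_word\<close>
  with the given one.\<close>

lemma eval_word_enc_circuit:
  assumes "valid_circuit C"
  shows "eval_word (enc_circuit C) z =
    (if length z = num_inputs C then Some (wire_values C z, out_wire C) else None)"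
proof (cases "eval_word (enc_circuit C) z")
  case None
  then show ?thesis
    using eval_word_Some[of "enc_circuit C" z "wire_values C z" "out_wire C"] assms by auto
next
  case (Some q)
  obtain vs j where q: "q = (vs, j)" by fastforce
  with Some obtain D where "enc_circuit C = enc_circuit D" "num_inputs D = length z"
    "vs = wire_values D z" "j = out_wire D"
    by (auto simp: eval_word_Some)
  moreover then have "D = C" using inj_enc_circuit by (auto dest: injD)
  ultimately show ?thesis using Some q by simp
qed

section \<open>Small refuting sets\<close>

text \<open>In a relation that holds between any two distinct points in at least one direction, some point
  is related to half of the others; removing it together with these halves the set.\<close>

lemma small_dominating_set:
  assumes "finite V" "card V < 2 ^ m" "\<And>x y. x \<in> V \<Longrightarrow> y \<in> V \<Longrightarrow> x \<noteq> y \<Longrightarrow> D x y \<or> D y x"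
  shows "\<exists>S \<subseteq> V. card S \<le> m \<and> (\<forall>x \<in> V. x \<in> S \<or> (\<exists>y \<in> S. D y x))"
  using assms
proof (induction m arbitrary: V)
  case 0
  then show ?case by (intro exI[of _ "{}"]) auto
next
  case (Suc m)
  define R where "R y = {x \<in> V. x \<noteq> y \<and> \<not> D y x}" for y
  show ?case
  proof (cases "V = {}")
    case True
    then show ?thesis by auto
  next
    case False
    have "\<exists>y \<in> V. card (R y) < 2 ^ m"
    proof (rule ccontr)
      assume "\<not> ?thesis"
      then have big: "2 ^ m \<le> card (R y)" if "y \<in> V" for y using that by (simp add: not_less)
      \<comment> \<open>The pairs missed by \<open>D\<close> never occur in both orders, so together
        with their converses they fit into the off-diagonal pairs. If every point missed at least
        \<open>2 ^ m\<close> others, this count would force \<open>card V\<close> to exceed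
        \<open>2 ^ Suc m\<close>.\<close>
      define N where "N = Sigma V R"
      have fin: "finite N" "finite (N\<inverse>)" using Suc.prems(1) by (auto simp: N_def R_def)
      have "N \<inter> N\<inverse> = {}" using Suc.prems(3) unfolding N_def R_def by blast
      then have "card N + card (N\<inverse>) = card (N \<union> N\<inverse>)" using fin by (simp add: card_Un_disjoint)
      also have "\<dots> \<le> card (V \<times> V - Id_on V)"
        by (rule card_mono) (use Suc.prems(1) in \<open>auto simp: N_def R_def\<close>)
      also have "\<dots> = card V * card V - card V"
      proof -
        have "card (Id_on V) = card V"
          unfolding Id_on_def by (simp add: card_UN_disjoint[OF Suc.prems(1)])
        moreover have "Id_on V \<subseteq> V \<times> V" by auto
        ultimately show ?thesis using Suc.prems(1)
          by (simp add: card_Diff_subset finite_subset card_cartesian_product)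
      qed
      finally have le: "2 * card N \<le> card V * (card V - 1)" by (simp add: diff_mult_distrib2)
      have "card V * 2 ^ m \<le> card N"
        unfolding N_def using Suc.prems(1) big sum_mono[of V "\<lambda>_. 2 ^ m" "\<lambda>y. card (R y)"]
        by (simp add: R_def)
      moreover have "card V * 2 ^ Suc m = 2 * (card V * 2 ^ m)" by simp
      ultimately have "card V * 2 ^ Suc m \<le> card V * (card V - 1)" using le by linarith
      moreover have "card V > 0" using False Suc.prems(1) by (simp add: card_gt_0_iff)
      ultimately have "2 ^ Suc m \<le> card V - 1" by (simp only: mult_le_cancel1)
      then show False using Suc.prems(2) by simp
    qed
    then obtain y where y: "y \<in> V" "card (R y) < 2 ^ m" by blast
    have "finite (R y)" "R y \<subseteq> V" using Suc.prems(1) by (auto simp: R_def)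
    with Suc.IH[OF _ y(2)] Suc.prems(3) obtain S where S: "S \<subseteq> R y" "card S \<le> m"
      "\<forall>x \<in> R y. x \<in> S \<or> (\<exists>y \<in> S. D y x)" by blast
    have "card (insert y S) \<le> Suc m" using S(2) by (metis card_insert_le_m1 diff_Suc_1 zero_less_Suc)
    moreover have "insert y S \<subseteq> V" using S(1) \<open>R y \<subseteq> V\<close> y(1) by auto
    moreover have "\<forall>x \<in> V. x \<in> insert y S \<or> (\<exists>z \<in> insert y S. D z x)"
      using S(3) by (auto simp: R_def)
    ultimately show ?thesis by blast
  qed
qed

lemma small_refuting_set:
  assumes V: "finite V" "card V < 2 ^ m" and total: "\<And>x y. x \<in> V \<Longrightarrow> y \<in> V \<Longrightarrow> x \<noteq> y \<Longrightarrow> D x y \<or> D y x"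
    and refuted: "\<And>x. x \<in> V \<Longrightarrow> \<exists>y \<in> V. D y x"
  shows "\<exists>S \<subseteq> V. card S \<le> 2 * m \<and> (\<forall>x \<in> V. \<exists>y \<in> S. D y x)"
proof -
  obtain S where S: "S \<subseteq> V" "card S \<le> m" "\<forall>x \<in> V. x \<in> S \<or> (\<exists>y \<in> S. D y x)"
    using small_dominating_set[of V m D] V total by blast
  obtain g where g: "g x \<in> V" "D (g x) x" if "x \<in> V" for x using refuted by metis
  have fS: "finite S" using S(1) V(1) finite_subset by blast
  have "card (S \<union> g ` S) \<le> card S + card (g ` S)" by (rule card_Un_le)
  also have "\<dots> \<le> 2 * m" using card_image_le[OF fS, of g] S(2) by simp
  finally have "card (S \<union> g ` S) \<le> 2 * m" .
  moreover have "S \<union> g ` S \<subseteq> V" using S(1) g by auto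
  moreover have "\<forall>x \<in> V. \<exists>y \<in> S \<union> g ` S. D y x" using S g by blast
  ultimately show ?thesis by blast
qed

section \<open>Acceptance of a list of blocks\<close>

lemma accepts_all:
  assumes "\<And>b r. block_ok e x b r"
  shows "accepts e x y"
  using assms by (induction e x y rule: accepts.induct) auto

text \<open>A block reads no further than \<open>length x\<close> bits, so the blocks that follow it
  in the concatenation do not influence its test.\<close>

lemma accepts_blocks:
  assumes "\<forall>b \<in> set bs. length (snd b) = length x"
  shows "accepts e x (concat (map (\<lambda>(b, z). b # z) bs)) \<longleftrightarrow> (\<forall>(b, z) \<in> set bs. block_ok e x b z)"
  using assms
proof (induction bs)
  case (Cons b bs)
  have "block (length x) (snd b @ r) = block (length x) (snd b)" for r
    using Cons.prems block_append[of "snd b" "length x"] block_append[of "snd b" "length x" "[]"] by simp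
  then have "block_ok e x c (snd b @ r) \<longleftrightarrow> block_ok e x c (snd b)" for c r
    by (simp add: block_ok_def)
  with Cons show ?case by (cases b) auto
qed simp

section \<open>The two provers\<close>

lemma block_ok_enc_circuit:
  assumes "valid_circuit C" "num_inputs C = 2 * n"
  shows "block_ok (enc_circuit C) x b r \<longleftrightarrow> length x = n \<and>
    (eval_circuit C (if b then x @ block n r else block n r @ x) = b \<or> block n r = x)"
proof (cases "length x = n")
  case True
  then show ?thesis
    by (simp add: block_ok_def Let_def eval_word_enc_circuit assms eval_circuit_def mult_2)
next
  case False
  then show ?thesis
    by (simp add: block_ok_def Let_def eval_word_enc_circuit assms)
qed

lemma polytime_fun_length:
  assumes "polytime_fun f"
  obtains p where "\<And>w. length (f w) \<le> poly p (length w)"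
proof -
  obtain M p where M: "valid_tm M"
    and Y: "\<And>ws. length ws = 1 \<Longrightarrow> yields_within M ws (poly p (sum_list (map length ws))) (f (ws ! 0))"
    using assms by (auto simp: polytime_fun_def polytime_def)
  have "length (f w) \<le> poly ([:1, 1:] + p) (length w)" for w
    using yields_within_length[OF M] Y[of "[w]"] by fastforce
  then show thesis by (rule that)
qed

lemma length_enc_circuit: "num_inputs C \<le> length (enc_circuit C)"
  by (simp add: enc_circuit_def enc_nat_def)

text \<open>Whatever \<open>y\<close> is, padding turns each of its blocks into a genuine string of
  length \<open>n\<close>, and this string is either the source itself or loses against it in both
  orders.\<close>

lemma source_accepted:
  assumes "e \<in> weak_tournament_source"
  shows "\<exists>x. length x \<le> length e \<and> (\<forall>y. accepts e x y)"
proof -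
  obtain C n x where C: "e = enc_circuit C" "valid_circuit C" "num_inputs C = 2 * n" and x: "length x = n"
    "\<forall>y. length y = n \<and> y \<noteq> x \<longrightarrow> eval_circuit C (x @ y) \<and> \<not> eval_circuit C (y @ x)"
    using assms by (auto simp: weak_tournament_source_def)
  have "block_ok e x b r" for b r
    unfolding C(1) block_ok_enc_circuit[OF C(2,3)] using x(1) x(2)[rule_format, of "block n r"] by auto
  then have "accepts e x y" for y by (rule accepts_all)
  moreover have "length x \<le> length e" using length_enc_circuit[of C] C x by simp
  ultimately show ?thesis by blast
qed

text \<open>If \<open>e\<close> encodes no valid circuit with an even number of inputs, evaluation
  fails for every \<open>x\<close>, and a single bit suffices as \<open>y\<close>. Otherwise a small
  refuting set is sent: at most \<open>2 * (n + 1)\<close> strings, each in two blocks of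
  \<open>n + 1\<close> bits, where \<open>n\<close> is at most \<open>length e\<close>.\<close>

lemma nonsource_refuted:
  assumes "e \<notin> weak_tournament_source"
  shows "\<exists>y. length y \<le> 4 * (length e + 1) * (length e + 1) \<and> (\<forall>x. \<not> accepts e x y)"
proof (cases "\<exists>C n. valid_circuit C \<and> e = enc_circuit C \<and> num_inputs C = 2 * n")
  case False
  have "eval_word e (x @ block (length x) []) = None" for x
  proof (cases "eval_word e (x @ block (length x) [])")
    case (Some q)
    then obtain C where "e = enc_circuit C" "valid_circuit C" "num_inputs C = 2 * length x"
      by (cases q) (auto simp: eval_word_Some mult_2)
    with False show ?thesis by blast
  qed
  then have "\<not> accepts e x [True]" for x by (simp add: block_ok_def)
  then show ?thesis by (intro exI[of _ "[True]"]) simp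
next
  case True
  then obtain C n where C: "valid_circuit C" "e = enc_circuit C" "num_inputs C = 2 * n" by blast
  let ?c = "eval_circuit C"
  define D where "D y x \<longleftrightarrow> y \<noteq> x \<and> (\<not> ?c (x @ y) \<or> ?c (y @ x))" for x y
  define V where "V = {x :: bool list. length x = n}"
  \<comment> \<open>The strict inequality demanded of the cardinality makes the exponent
    \<open>n + 1\<close> instead of \<open>n\<close>.\<close>
  have V: "finite V" "card V < 2 ^ (n + 1)"
    using finite_lists_length_eq[of "UNIV :: bool set" n] card_lists_length_eq[of "UNIV :: bool set" n]
    by (simp_all add: V_def)
  have "\<exists>y \<in> V. D y x" if "x \<in> V" for x
    using assms C that unfolding weak_tournament_source_def V_def D_def by blast
  with small_refuting_set[OF V, of D] obtain S where S: "S \<subseteq> V" "card S \<le> 2 * (n + 1)"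
    "\<forall>x \<in> V. \<exists>y \<in> S. D y x" by (auto simp: D_def)
  obtain zs where zs: "set zs = S" "length zs = card S"
    using S(1) V(1) finite_subset finite_distinct_list distinct_card by metis
  \<comment> \<open>Which disjunct of \<open>D z x\<close> holds depends on \<open>x\<close>. With
    both orders sent for every \<open>z\<close>, one of the two blocks rejects.\<close>
  define bs where "bs = map (Pair True) zs @ map (Pair False) zs"
  define y where "y = concat (map (\<lambda>(b, z). b # z) bs)"
  have len: "\<forall>b \<in> set bs. length (snd b) = n" using zs S(1) by (auto simp: bs_def V_def)
  then have "length y = length bs * (n + 1)" unfolding y_def by (induction bs) auto
  also have "\<dots> \<le> (4 * (n + 1)) * (n + 1)"
    using S(2) by (intro mult_right_mono) (simp_all add: bs_def zs)
  also have "\<dots> \<le> 4 * (length e + 1) * (length e + 1)"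
    using length_enc_circuit[of C] C by (intro mult_mono) simp_all
  finally have ly: "length y \<le> 4 * (length e + 1) * (length e + 1)" .
  \<comment> \<open>An \<open>x\<close> of the wrong length is only caught if some block is
    evaluated, so \<open>y\<close>, and with it \<open>S\<close>, has to be nonempty.\<close>
  have "replicate n True \<in> V" by (simp add: V_def)
  then have "S \<noteq> {}" using S(3) by auto
  then obtain b r where y: "y = b # r" using zs by (cases zs) (auto simp: y_def bs_def)
  have "\<not> accepts e x y" for x
  proof (cases "length x = n")
    case False
    then show ?thesis by (simp add: y C(2) block_ok_enc_circuit[OF C(1,3)])
  next
    case True
    then obtain z where z: "z \<in> S" "D z x" using S(3) by (auto simp: V_def)
    then have "length z = n" using S(1) by (auto simp: V_def)
    then have bz: "block n z = z" using block_append[of z n "[]"] by simp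
    have mem: "(True, z) \<in> set bs" "(False, z) \<in> set bs" using z zs by (auto simp: bs_def)
    have "\<not> block_ok e x True z \<or> \<not> block_ok e x False z"
      using z(2) by (auto simp: C(2) block_ok_enc_circuit[OF C(1,3)] bz D_def)
    then show ?thesis using mem accepts_blocks[of bs x e] len True by (auto simp: y_def)
  qed
  with ly show ?thesis by blast
qed

theorem theorem3p3: "PTW \<subseteq> S2P"
proof
  fix L assume "L \<in> PTW"
  then obtain f where f: "polytime_fun f" "\<And>w. w \<in> L \<longleftrightarrow> f w \<in> weak_tournament_source"
    by (auto simp: PTW_def poly_reducible_def)
  obtain p where p: "\<And>w. length (f w) \<le> poly p (length w)"
    using polytime_fun_length[OF f(1)] by blast
  \<comment> \<open>One polynomial has to bound both provers: the summand \<open>p\<close> covers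
    \<open>x\<close>, and the product covers \<open>y\<close>.\<close>
  define q where "q = p + [:4:] * (p + 1) * (p + 1)"
  have "\<exists>x. length x \<le> poly q (length w) \<and>
      (\<forall>y. length y \<le> poly q (length w) \<longrightarrow> accepts (f w) x y)" if "w \<in> L" for w
  proof -
    obtain x where "length x \<le> length (f w)" "\<forall>y. accepts (f w) x y"
      using source_accepted \<open>w \<in> L\<close> f(2) by blast
    then show ?thesis using p[of w] by (intro exI[of _ x]) (simp add: q_def)
  qed
  moreover have "\<exists>y. length y \<le> poly q (length w) \<and>
      (\<forall>x. length x \<le> poly q (length w) \<longrightarrow> \<not> accepts (f w) x y)" if "w \<notin> L" for w
  proof -
    obtain y where y: "length y \<le> 4 * (length (f w) + 1) * (length (f w) + 1)"
      "\<forall>x. \<not> accepts (f w) x y"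
      using nonsource_refuted \<open>w \<notin> L\<close> f(2) by blast
    have "4 * (length (f w) + 1) * (length (f w) + 1) \<le>
        4 * (poly p (length w) + 1) * (poly p (length w) + 1)"
      using p[of w] by (intro mult_mono) simp_all
    then have "length y \<le> poly p (length w) + 4 * (poly p (length w) + 1) * (poly p (length w) + 1)"
      using y(1) by linarith
    then have "length y \<le> poly q (length w)" by (simp add: q_def algebra_simps)
    then show ?thesis using y(2) by blast
  qed
  ultimately show "L \<in> S2P"
    using polytime_pred3_accepts[OF f(1)] unfolding S2P_def by blast
qed

end
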